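(* Let $S\subset\mathbb{R}^d$ be a crystal or a cut-and-project set with a convex window. Then the fractional Helly number of $S$ is at most $d+1$. That is, for every $\alpha\in(0,1]$ there exists a constant $\beta=\beta(S,\alpha)>0$ with the following property. Let $\mathcal{F}$ be a family of $n$ convex sets in $\mathbb{R}^d$ such that at least $\alpha\binom{n}{d+1}$ subfamilies of $d+1$ sets intersect at a point from $S$ (i.e. the $d+1$ sets have a common point belonging to $S$). Then there exists a point of $S$ contained in at least $\beta n$ sets from $\mathcal{F}$.
   Context: Crystal: let $\Lambda$ be a full rank lattice in $\mathbb{R}^d$, i.e. the set of all integer linear combinations of a basis of $\mathbb{R}^d$. Any union of finitely many translates of $\Lambda$ is called a $d$-dimensional crystal; more precisely, if $\mathbf{t}_1,\ldots,\mathbf{t}_m\in\mathbb{R}^d$ satisfy $\mathbf{t}_i-\mathbf{t}_j\notin\Lambda$ for all $i\neq j$, then $\bigcup_{i=1}^m(\Lambda+\mathbf{t}_i)$ is a $d$-dimensional crystal (an $m$-crystal). Cut-and-project set: write $\mathbb{R}^{d+k}=\mathbb{R}^d\times\mathbb{R}^k$ and let $\Lambda$ be a lattice in $\mathbb{R}^{d+k}$. Let $\pi_1:\mathbb{R}^{d+k}\to\mathbb{R}^d$ and $\pi_2:\mathbb{R}^{d+k}\to\mathbb{R}^k$ be the two projections on the complementary subspaces, such that $\pi_1|_\Lambda$ is injective and $\pi_2(\Lambda)$ is dense in $\mathbb{R}^k$. Let $W\subset\mathbb{R}^k$ be a relatively compact set with non-empty interior, called the window. Then $$V(\mathbb{R}^d,\mathbb{R}^k,\Lambda,W)=\{\pi_1(\mathbf{x})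 : \mathbf{x}\in\Lambda,\ \pi_2(\mathbf{x})\in W\}\subset\mathbb{R}^d$$ is called a cut-and-project set with window $W$.
   Formalization: The family is required to have n ≥ d+1 members; for n ≤ d the binomial coefficient is 0, so the condition is vacuous and the claim fails, for instance for the one-member family consisting of the empty set. *)

theory Defs
  imports "HOL-Analysis.Analysis" "HOL-Library.Extended_Nat"
begin

definition full_rank_lattice :: "'a::euclidean_space set \<Rightarrow> bool" where
  "full_rank_lattice L \<longleftrightarrow>
     (\<exists>B. independent B \<and> span B = UNIV \<and>
          L = {\<Sum>b\<in>B. of_int (c b) *\<^sub>R b |c :: 'a \<Rightarrow> int. True})"

text \<open>The union of translates is over at least one translate: a crystal is never empty.\<close>

definition crystal :: "'a::euclidean_space set \<Rightarrow> bool" where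
  "crystal S \<longleftrightarrow>
     (\<exists>L T. full_rank_lattice L \<and> finite T \<and> T \<noteq> {} \<and>
            (\<forall>s\<in>T. \<forall>t\<in>T. s \<noteq> t \<longrightarrow> s - t \<notin> L) \<and>
            S = (\<Union>t\<in>T. (\<lambda>x. x + t) ` L))"

text \<open>The ambient space $\mathbb{R}^{d+k}$ is the product type, so that the two projections
  are \<^const>\<open>fst\<close> and \<^const>\<open>snd\<close>.\<close>

definition cut_and_project_scheme ::
    "('a::euclidean_space \<times> 'b::euclidean_space) set \<Rightarrow> bool" where
  "cut_and_project_scheme L \<longleftrightarrow>
     full_rank_lattice L \<and> inj_on fst L \<and> closure (snd ` L) = UNIV"

definition is_window :: "'b::euclidean_space set \<Rightarrow> bool" where
  "is_window W \<longleftrightarrow> compact (closure W) \<and> interior W \<noteq> {}"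

definition cut_and_project_set ::
    "('a::euclidean_space \<times> 'b::euclidean_space) set \<Rightarrow> 'b set \<Rightarrow> 'a set" where
  "cut_and_project_set L W = {fst x |x. x \<in> L \<and> snd x \<in> W}"

text \<open>Families are indexed by \<open>{..<n}\<close>, so repeated members are allowed. The side condition
  \<open>k \<le> n\<close> is essential: for \<open>n < k\<close> the binomial coefficient vanishes, the hypothesis on the
  intersecting subfamilies becomes vacuous, and the conclusion fails (take one empty set).\<close>

definition fractional_helly_property :: "'a::euclidean_space set \<Rightarrow> nat \<Rightarrow> bool" where
  "fractional_helly_property S k \<longleftrightarrow>
     (\<forall>\<alpha>::real. 0 < \<alpha> \<and> \<alpha> \<le> 1 \<longrightarrow>
       (\<exists>\<beta>::real. 0 < \<beta> \<and>
         (\<forall>(n::nat) (F :: nat \<Rightarrow> 'a set).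
            k \<le> n \<longrightarrow> (\<forall>i<n. convex (F i)) \<longrightarrow>
            \<alpha> * real (n choose k)
              \<le> real (card {I. I \<subseteq> {..<n} \<and> card I = k \<and> (\<exists>x\<in>S. \<forall>i\<in>I. x \<in> F i)}) \<longrightarrow>
            (\<exists>x\<in>S. \<beta> * real n \<le> real (card {i. i < n \<and> x \<in> F i})))))"

text \<open>The value is \<open>\<infinity>\<close> if no \<open>k\<close> has the property.\<close>

definition fractional_helly_number :: "'a::euclidean_space set \<Rightarrow> enat" where
  "fractional_helly_number S = (INF k\<in>{k. fractional_helly_property S k}. enat k)"

end

theory Submission
  imports Defs "HOL-Library.Ramsey"
begin

text \<open>
  Let \<open>S\<close> be locally finite and such that among any \<open>h + 1\<close> of its points two have their midpoint
  in \<open>S\<close>; by a parity argument crystals and cut-and-project sets with convex window are of this kind.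
  Then convex sets satisfy a Helly theorem over \<open>S\<close> with Helly number at most \<open>h\<close>, and therefore every finite
  subset of \<open>S\<close> has a centrepoint in \<open>S\<close>: a half-space containing it contains at least
  a fraction \<open>1 / h\<close> of the points.

  Write \<open>m = d + 1\<close>. If a positive fraction of the \<open>m\<close>-tuples of sets meet in \<open>S\<close>, the
  \<open>m\<close>-partite hypergraph theorem of Erdos yields large classes \<open>T\<^sub>1, \<dots>, T\<^sub>m\<close> of sets all of whose
  transversals meet in \<open>S\<close>. By Ramsey's theorem, either one can pick two sets from each class such that
  all \<open>2 ^ m\<close> sign patterns with respect to \<open>m\<close> separating hyperplanes are realised, which is impossible in
  dimension \<open>m - 1\<close>; or in some class no separation is ever possible, and then a centrepoint
  lies in \<open>h\<close> sets of that class. By averaging, a positive fraction of the \<open>h\<close>-tuples meet in \<open>S\<close>, and the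
  standard argument deriving the fractional Helly theorem from the Helly theorem applies.
\<close>

section \<open>Grids in dense and in coloured products\<close>

lemma pigeonhole_average:
  assumes "finite A" "finite B" "B \<noteq> {}" "f ` A \<subseteq> B"
  shows "\<exists>b\<in>B. card A \<le> card B * card {a \<in> A. f a = b}"
proof (rule ccontr)
  assume "\<not> ?thesis"
  then have less: "card B * card {a \<in> A. f a = b} < card A" if "b \<in> B" for b
    using that by (auto simp: not_le)
  have "card A = (\<Sum>b\<in>B. card {a \<in> A. f a = b})"
    using sum.group[of A B f "\<lambda>_. 1::nat"] assms by simp
  then have "card B * card A = (\<Sum>b\<in>B. card B * card {a \<in> A. f a = b})"
    by (simp add: sum_distrib_left)
  also have "\<dots> < (\<Sum>b\<in>B. card A)"
    using assms less by (intro sum_strict_mono) auto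
  finally show False by simp
qed

text \<open>Elements are deleted one at a time, one of value at most \<open>a\<close> if there is
  one and an arbitrary one otherwise; neither choice brings the average below \<open>a\<close>. This
  cuts a coordinate down to a size independent of the product while keeping the density.\<close>

lemma subset_sum_ge_average:
  fixes f :: "'v \<Rightarrow> real" and a :: real
  assumes "finite V" "r \<le> card V" "a * card V \<le> sum f V"
  shows "\<exists>U\<subseteq>V. card U = r \<and> a * r \<le> sum f U"
  using assms
proof (induction "card V - r" arbitrary: V)
  case 0
  then show ?case by (intro exI[of _ V]) auto
next
  case (Suc n)
  from Suc.hyps(2) have gt: "r < card V" by simp
  have "\<exists>v\<in>V. a * (real (card V) - 1) \<le> sum f (V - {v})"
  proof (cases "\<exists>v\<in>V. f v \<le> a")
    case True
    then obtain v where v: "v \<in> V" "f v \<le> a" by blast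
    have "sum f V = f v + sum f (V - {v})"
      using v Suc.prems by (simp add: sum.remove)
    with v Suc.prems(3) show ?thesis
      by (intro bexI[of _ v]) (auto simp: algebra_simps)
  next
    case False
    from gt have "V \<noteq> {}" by auto
    then obtain v where v: "v \<in> V" by blast
    have "(\<Sum>w\<in>V - {v}. a) \<le> sum f (V - {v})"
      using False by (intro sum_mono) force
    moreover have "real (card (V - {v})) = real (card V) - 1"
      using v Suc.prems gt by (simp add: of_nat_diff)
    ultimately show ?thesis
      using v by (intro bexI[of _ v]) (auto simp: mult.commute)
  qed
  then obtain v where v: "v \<in> V" "a * (real (card V) - 1) \<le> sum f (V - {v})" by blast
  have c: "card (V - {v}) = card V - 1" using v Suc.prems by simp
  have "\<exists>U\<subseteq>V - {v}. card U = r \<and> a * r \<le> sum f U"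
  proof (intro Suc.hyps(1))
    show "a * real (card (V - {v})) \<le> sum f (V - {v})"
      using v(2) c gt by (simp add: of_nat_diff del: One_nat_def)
  qed (use Suc.hyps(2) Suc.prems c gt in auto)
  then show ?case by blast
qed

lemma PiE_insert_slices:
  assumes "finite Y" "finite U" "k \<notin> K" "Y \<subseteq> PiE K V" "E \<subseteq> {y(k := v) | y v. y \<in> Y \<and> v \<in> U}"
  shows "card E = (\<Sum>v\<in>U. card {y \<in> Y. y(k := v) \<in> E})"
proof -
  let ?P = "SIGMA v:U. {y \<in> Y. y(k := v) \<in> E}"
  have "bij_betw (\<lambda>(v, y). y(k := v)) ?P E"
    unfolding bij_betw_def
  proof
    show "inj_on (\<lambda>(v, y). y(k := v)) ?P"
    proof (rule inj_onI, clarify)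
      fix v y w z
      assume a: "v \<in> U" "y \<in> Y" "w \<in> U" "z \<in> Y" and eq: "y(k := v) = z(k := w)"
      have "v = w" using eq by (metis fun_upd_same)
      \<comment> \<open>At \<open>k\<close> itself both functions are \<open>undefined\<close>,
        because \<open>k\<close> lies outside \<open>K\<close>.\<close>
      moreover have "y j = z j" for j
      proof (cases "j = k")
        case True
        then show ?thesis using a assms(3,4) by (metis PiE_arb subsetD)
      next
        case False
        then show ?thesis using eq by (metis fun_upd_other)
      qed
      ultimately show "v = w \<and> y = z" by auto
    qed
    show "(\<lambda>(v, y). y(k := v)) ` ?P = E"
      using assms(5) by force
  qed
  then have "card E = card ?P" by (simp add: bij_betw_same_card)
  also have "\<dots> = (\<Sum>v\<in>U. card {y \<in> Y. y(k := v) \<in> E})"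
    using assms by (simp add: card_SigmaI)
  finally show ?thesis .
qed

text \<open>Induction on the number of coordinates. Once the new coordinate is cut down to
  \<open>r\<close> vertices, many points of the remaining product have at least \<open>t\<close>
  extensions in \<open>E\<close>. There are only \<open>r choose t\<close> possible
  \<open>t\<close>-sets of extensions, so one of them serves a positive fraction of these points, to
  which the induction hypothesis applies.\<close>

lemma dense_imp_grid:
  fixes K :: "'k set" and \<alpha> :: real and t :: nat
  assumes "finite K" "0 < \<alpha>"
  shows "\<exists>R. \<forall>(V :: 'k \<Rightarrow> 'v set) E. (\<forall>k\<in>K. finite (V k) \<and> R \<le> card (V k)) \<longrightarrow>
    E \<subseteq> PiE K V \<longrightarrow> \<alpha> * (\<Prod>k\<in>K. card (V k)) \<le> card E \<longrightarrow>
    (\<exists>T. (\<forall>k\<in>K. T k \<subseteq> V k \<and> card (T k) = t) \<and> PiE K T \<subseteq> E)"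
  using assms
proof (induction K arbitrary: \<alpha> rule: finite_induct)
  case empty
  have "E = {\<lambda>_. undefined}"
    if "E \<subseteq> {\<lambda>_. undefined}" "\<alpha> \<le> real (card E)" for E :: "('k \<Rightarrow> 'v) set"
    using that empty by (cases "E = {}") auto
  then show ?case by (auto simp: PiE_empty_domain)
next
  case (insert k K)
  \<comment> \<open>With \<open>2 * t <= \<alpha> * r\<close>, the points with fewer than
    \<open>t\<close> extensions account for at most half of the density.\<close>
  define r where "r = nat \<lceil>2 * t / \<alpha>\<rceil> + t + 1"
  have "2 * t / \<alpha> \<le> r" unfolding r_def by linarith
  then have r: "2 * t \<le> \<alpha> * r" "t \<le> r" "0 < r"
    using insert.prems by (simp_all add: pos_divide_le_eq mult.commute) (simp_all add: r_def)
  \<comment> \<open>One half is lost to the points with few extensions, the factor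
    \<open>r choose t\<close> to the pigeonhole.\<close>
  define \<alpha>' where "\<alpha>' = \<alpha> / 2 / (r choose t)"
  have "0 < \<alpha>'" using insert.prems r by (simp add: \<alpha>'_def)
  from insert.IH[OF this] obtain R where R:
    "\<forall>(V :: 'k \<Rightarrow> 'v set) E. (\<forall>k\<in>K. finite (V k) \<and> R \<le> card (V k)) \<longrightarrow>
      E \<subseteq> PiE K V \<longrightarrow> \<alpha>' * (\<Prod>k\<in>K. card (V k)) \<le> card E \<longrightarrow>
      (\<exists>T. (\<forall>k\<in>K. T k \<subseteq> V k \<and> card (T k) = t) \<and> PiE K T \<subseteq> E)" ..
  show ?case
  proof (intro exI[of _ "max R r"] allI impI)
    fix V :: "'k \<Rightarrow> 'v set" and E
    assume V: "\<forall>k\<in>insert k K. finite (V k) \<and> max R r \<le> card (V k)"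
      and E: "E \<subseteq> PiE (insert k K) V"
      and dens: "\<alpha> * (\<Prod>k\<in>insert k K. card (V k)) \<le> card E"
    define Y where "Y = PiE K V"
    have finY: "finite Y" and cardY: "card Y = (\<Prod>k\<in>K. card (V k))"
      using V insert.hyps by (auto simp: Y_def card_PiE intro!: finite_PiE)
    have "E \<subseteq> {y(k := v) | y v. y \<in> Y \<and> v \<in> V k}"
      using E unfolding Y_def PiE_insert_eq by fast
    then have "card E = (\<Sum>v\<in>V k. card {y \<in> Y. y(k := v) \<in> E})"
      using finY V insert.hyps by (intro PiE_insert_slices[where V=V and K=K]) (auto simp: Y_def)
    then have "(\<alpha> * card Y) * card (V k) \<le> (\<Sum>v\<in>V k. real (card {y \<in> Y. y(k := v) \<in> E}))"
      using dens insert.hyps by (simp add: cardY mult_ac)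
    then obtain U where U: "U \<subseteq> V k" "card U = r"
      "\<alpha> * card Y * r \<le> (\<Sum>v\<in>U. real (card {y \<in> Y. y(k := v) \<in> E}))"
      using subset_sum_ge_average[of "V k" r "\<alpha> * card Y"
          "\<lambda>v. real (card {y \<in> Y. y(k := v) \<in> E})"] V by force
    have finU: "finite U" using U V finite_subset by blast
    define N where "N y = {v \<in> U. y(k := v) \<in> E}" for y
    have cN: "card (N y) \<le> r" for y
      using card_mono[OF finU, of "N y"] U by (simp add: N_def)
    have swap: "(\<Sum>v\<in>U. card {y \<in> Y. y(k := v) \<in> E}) = (\<Sum>y\<in>Y. card (N y))"
    proof -
      have "(\<Sum>v\<in>U. card {y \<in> Y. y(k := v) \<in> E}) = (\<Sum>v\<in>U. \<Sum>y | y \<in> Y \<and> y(k := v) \<in> E. 1)"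
        by simp
      also have "\<dots> = (\<Sum>y\<in>Y. \<Sum>v | v \<in> U \<and> y(k := v) \<in> E. 1)"
        using finU finY by (rule sum.swap_restrict)
      finally show ?thesis by (simp add: N_def)
    qed
    define Yg where "Yg = {y \<in> Y. t \<le> card (N y)}"
    have "(\<Sum>y\<in>Y. card (N y)) = (\<Sum>y\<in>Yg. card (N y)) + (\<Sum>y\<in>Y - Yg. card (N y))"
      using finY by (simp add: Yg_def sum.subset_diff[of Yg Y])
    also have "\<dots> \<le> (\<Sum>y\<in>Yg. r) + (\<Sum>y\<in>Y - Yg. t)"
      using cN by (intro add_mono sum_mono) (auto simp: Yg_def)
    also have "\<dots> \<le> card Yg * r + card Y * t"
      using card_mono[OF finY, of "Y - Yg"] by simp
    finally have "real (\<Sum>y\<in>Y. card (N y)) \<le> real (card Yg * r + card Y * t)"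
      by (rule of_nat_mono)
    then have "\<alpha> * card Y * r \<le> card Yg * r + card Y * t"
      using U(3) swap by (simp flip: of_nat_sum)
    moreover have "real (card Y) * (2 * real t) \<le> card Y * (\<alpha> * r)"
      using r by (intro mult_left_mono) auto
    ultimately have "\<alpha> / 2 * card Y * r \<le> card Yg * r" by (simp add: mult_ac)
    then have Yg: "\<alpha> / 2 * card Y \<le> card Yg" using r by simp
    have "\<exists>T. T \<subseteq> N y \<and> card T = t" if "y \<in> Yg" for y
      using that obtain_subset_with_card_n[of t "N y"] by (auto simp: Yg_def)
    then obtain \<tau> where \<tau>: "\<And>y. y \<in> Yg \<Longrightarrow> \<tau> y \<subseteq> N y \<and> card (\<tau> y) = t" by metis
    define B where "B = {T. T \<subseteq> U \<and> card T = t}"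
    have cB: "card B = r choose t" unfolding B_def using U finU by (simp add: n_subsets)
    have "B \<noteq> {}" using cB r by auto
    moreover have "finite B" unfolding B_def using finU by simp
    moreover have "\<tau> ` Yg \<subseteq> B" using \<tau> by (auto simp: B_def N_def)
    moreover have "finite Yg" using finY by (simp add: Yg_def)
    ultimately obtain T0 where T0: "T0 \<in> B" "card Yg \<le> card B * card {y \<in> Yg. \<tau> y = T0}"
      using pigeonhole_average[of Yg B \<tau>] by auto
    define E' where "E' = {y \<in> Yg. \<tau> y = T0}"
    have "real (card Yg) \<le> real (card B) * card E'"
      using T0(2) by (simp add: E'_def flip: of_nat_mult)
    then have "\<alpha> / 2 * card Y \<le> (r choose t) * card E'" using Yg cB by simp
    then have "\<alpha>' * card Y \<le> card E'"
      using r by (simp add: \<alpha>'_def pos_divide_le_eq mult.commute)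
    moreover have "E' \<subseteq> PiE K V" by (auto simp: E'_def Yg_def Y_def)
    moreover have "\<forall>k\<in>K. finite (V k) \<and> R \<le> card (V k)" using V by auto
    ultimately obtain T where T: "\<forall>k\<in>K. T k \<subseteq> V k \<and> card (T k) = t" "PiE K T \<subseteq> E'"
      using R[rule_format, of V E'] unfolding cardY by blast
    have "PiE (insert k K) (T(k := T0)) \<subseteq> E"
    proof
      fix g assume g: "g \<in> PiE (insert k K) (T(k := T0))"
      define y where "y = g(k := undefined)"
      have "y \<in> PiE K T"
      proof (rule PiE_I)
        fix j assume "j \<in> K"
        then show "y j \<in> T j"
          using PiE_mem[OF g, of j] insert.hyps by (auto simp: y_def)
      next
        fix j assume "j \<notin> K"
        then show "y j = undefined"
          using PiE_arb[OF g, of j] by (auto simp: y_def)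
      qed
      then have "y \<in> E'" using T by blast
      then have "T0 \<subseteq> N y" using \<tau> by (auto simp: E'_def)
      moreover have "g k \<in> T0" using PiE_mem[OF g, of k] by simp
      ultimately have "y(k := g k) \<in> E" by (auto simp: N_def)
      then show "g \<in> E" by (simp add: y_def)
    qed
    moreover have "\<forall>j\<in>insert k K. (T(k := T0)) j \<subseteq> V j \<and> card ((T(k := T0)) j) = t"
      using T T0(1) U by (auto simp: B_def)
    ultimately show "\<exists>T. (\<forall>k\<in>insert k K. T k \<subseteq> V k \<and> card (T k) = t) \<and> PiE (insert k K) T \<subseteq> E"
      by (intro exI[of _ "T(k := T0)"] conjI)
  qed
qed

section \<open>Monochromatic grids from Ramsey's theorem\<close>

lemma rank_bij_betw:
  fixes H :: "nat set"
  assumes "finite H"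
  shows "bij_betw (\<lambda>x. card {y \<in> H. y < x}) H {..<card H}"
proof -
  have mono: "card {z \<in> H. z < x} < card {z \<in> H. z < y}" if "x \<in> H" "x < y" for x y
  proof (rule psubset_card_mono)
    show "{z \<in> H. z < x} \<subset> {z \<in> H. z < y}" using that by fastforce
  qed (use assms in simp)
  have "inj_on (\<lambda>x. card {y \<in> H. y < x}) H"
    by (rule linorder_inj_onI) (use mono in fastforce)+
  moreover have "(\<lambda>x. card {y \<in> H. y < x}) ` H \<subseteq> {..<card H}"
    using assms by (auto intro!: psubset_card_mono)
  ultimately show ?thesis
    by (simp add: bij_betw_def card_image card_subset_eq)
qed

text \<open>If a finite \<open>H\<close> has \<open>m * s\<close> elements with \<open>s\<close>
  positive, these are for \<open>k < m\<close> its \<open>m\<close> consecutive blocks of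
  \<open>s\<close> elements in increasing order. A single set thus encodes an \<open>m\<close>-tuple
  of sets, which turns colourings of tuples into colourings of sets.\<close>

definition rank_block :: "nat set \<Rightarrow> nat \<Rightarrow> nat \<Rightarrow> nat set" where
  "rank_block H s k = {x \<in> H. card {y \<in> H. y < x} div s = k}"

lemma card_rank_block:
  assumes "finite H" "card H = m * s" "0 < s" "k < m"
  shows "card (rank_block H s k) = s"
proof -
  let ?r = "\<lambda>x. card {y \<in> H. y < x}"
  have bij: "bij_betw ?r H {..<m * s}"
    using rank_bij_betw[OF assms(1)] assms(2) by simp
  have "?r ` rank_block H s k = {i \<in> {..<m * s}. i div s = k}"
    using bij by (auto simp: rank_block_def bij_betw_def)
  also have "\<dots> = {k * s..<k * s + s}"
  proof (intro equalityI subsetI)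
    fix i assume "i \<in> {i \<in> {..<m * s}. i div s = k}"
    then show "i \<in> {k * s..<k * s + s}"
      using dividend_less_div_times[OF assms(3), of i] by (auto simp: add.commute)
  next
    fix i assume i: "i \<in> {k * s..<k * s + s}"
    then have "i div s = k" by (intro div_nat_eqI) (auto simp: mult.commute)
    moreover have "(k + 1) * s \<le> m * s" using assms(4) by (intro mult_right_mono) auto
    ultimately show "i \<in> {i \<in> {..<m * s}. i div s = k}" using i by auto
  qed
  finally have "card (?r ` rank_block H s k) = s" by simp
  moreover have "inj_on ?r (rank_block H s k)"
    using bij by (auto simp: bij_betw_def rank_block_def intro: inj_on_subset)
  ultimately show ?thesis by (simp add: card_image)
qed

lemma rank_block_less:
  assumes "finite H" "x \<in> rank_block H s j" "y \<in> rank_block H s k" "j < k"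
  shows "x < y"
proof (rule ccontr)
  assume "\<not> x < y"
  then have "card {z \<in> H. z < y} \<le> card {z \<in> H. z < x}"
    using assms(1) by (intro card_mono) auto
  from div_le_mono[OF this, of s] have "k \<le> j" using assms by (auto simp: rank_block_def)
  with assms(4) show False by simp
qed

text \<open>The encoding is faithful for tuples in increasing position: below a point of
  \<open>T k\<close> lie the \<open>k\<close> earlier blocks and fewer than \<open>s\<close> points
  of \<open>T k\<close> itself, so its rank divided by \<open>s\<close> is \<open>k\<close>.\<close>

lemma rank_block_Union:
  fixes T :: "nat \<Rightarrow> nat set"
  assumes "0 < s" and T: "\<And>k. k < m \<Longrightarrow> finite (T k) \<and> card (T k) = s"
    and less: "\<And>j k x y. j < k \<Longrightarrow> k < m \<Longrightarrow> x \<in> T j \<Longrightarrow> y \<in> T k \<Longrightarrow> x < y"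
  shows "card (\<Union>k<m. T k) = m * s \<and> (\<forall>k<m. rank_block (\<Union>k<m. T k) s k = T k)"
proof (intro conjI allI impI)
  have disj: "T i \<inter> T j = {}" if "i < j" "j < m" for i j
    using less[OF that] by (meson disjoint_iff less_irrefl)
  have card_UN: "card (\<Union>j<k. T j) = k * s" if "k \<le> m" for k
  proof -
    have "T i \<inter> T j = {}" if "i < k" "j < k" "i \<noteq> j" for i j
      using that disj[of i j] disj[of j i] \<open>k \<le> m\<close> by (cases i j rule: linorder_cases) (simp_all add: Int_commute)
    then have "card (\<Union>j<k. T j) = (\<Sum>j<k. card (T j))"
      using T \<open>k \<le> m\<close> by (intro card_UN_disjoint) auto
    also have "\<dots> = (\<Sum>j<k. s)" using T \<open>k \<le> m\<close> by (intro sum.cong) auto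
    finally show ?thesis by simp
  qed
  then show "card (\<Union>k<m. T k) = m * s" by simp
  have rank: "card {y \<in> (\<Union>k<m. T k). y < x} div s = k" if "k < m" "x \<in> T k" for k x
  proof -
    have "{y \<in> (\<Union>k<m. T k). y < x} = (\<Union>j<k. T j) \<union> {y \<in> T k. y < x}"
    proof (intro equalityI subsetI)
      fix y assume "y \<in> {y \<in> (\<Union>k<m. T k). y < x}"
      then obtain j where "j < m" "y \<in> T j" "y < x" by auto
      moreover have "\<not> k < j" using less[of k j x y] \<open>j < m\<close> \<open>y \<in> T j\<close> \<open>y < x\<close> that by auto
      ultimately show "y \<in> (\<Union>j<k. T j) \<union> {y \<in> T k. y < x}"
        by (cases j k rule: linorder_cases) auto
    next
      fix y assume "y \<in> (\<Union>j<k. T j) \<union> {y \<in> T k. y < x}"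
      then consider j where "j < k" "y \<in> T j" | "y \<in> T k" "y < x" by blast
      then show "y \<in> {y \<in> (\<Union>k<m. T k). y < x}"
      proof cases
        case 1
        then show ?thesis using less[of j k y x] that by force
      qed (use that in blast)
    qed
    moreover have "(\<Union>j<k. T j) \<inter> {y \<in> T k. y < x} = {}"
      using disj that(1) by blast
    moreover have "finite (\<Union>j<k. T j)" using T that by auto
    ultimately have "card {y \<in> (\<Union>k<m. T k). y < x} = k * s + card {y \<in> T k. y < x}"
      using card_UN[of k] T that by (simp add: card_Un_disjoint)
    moreover have "card {y \<in> T k. y < x} < s"
      using T[OF that(1)] that by (auto intro!: psubset_card_mono)
    ultimately show ?thesis by simp
  qed
  fix k assume that: "k < m"
  show "rank_block (\<Union>k<m. T k) s k = T k"
  proof (intro equalityI subsetI)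
    fix x assume "x \<in> rank_block (\<Union>k<m. T k) s k"
    then obtain j where "j < m" "x \<in> T j" "card {y \<in> (\<Union>k<m. T k). y < x} div s = k"
      unfolding rank_block_def by blast
    then show "x \<in> T k" using rank by metis
  next
    fix x assume "x \<in> T k"
    then show "x \<in> rank_block (\<Union>k<m. T k) s k"
      using rank[OF that] that unfolding rank_block_def by blast
  qed
qed

text \<open>Ramsey's theorem for subsets of size \<open>m * s\<close> is enough when each set is
  coloured by the tuple of its blocks. A monochromatic set of \<open>m * M\<close> points is cut
  into \<open>m\<close> blocks; a choice of \<open>s\<close> points from each is in increasing
  position, hence is the tuple of blocks of its union.\<close>

lemma product_ramsey:
  fixes m M s q :: nat
  assumes "0 < M" "0 < s"
  shows "\<exists>N. \<forall>c :: (nat \<Rightarrow> nat set) \<Rightarrow> nat. (\<forall>T. c T < q) \<longrightarrow>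
    (\<exists>H. \<exists>i<q. (\<forall>k<m. H k \<subseteq> {..<N} \<and> card (H k) = M) \<and>
      (\<forall>T \<in> PiE {..<m} (\<lambda>k. nsets (H k) s). c T = i))"
proof -
  obtain N :: nat where N: "partn_lst {..<N} (replicate q (m * M)) (m * s)"
    using ramsey_full by blast
  show ?thesis
  proof (intro exI[of _ N] allI impI)
    fix c :: "(nat \<Rightarrow> nat set) \<Rightarrow> nat" assume c: "\<forall>T. c T < q"
    \<comment> \<open>Restricting to \<open>{..<m}\<close> makes the tuple extensional, so that it
      can equal an element of \<open>PiE\<close>.\<close>
    define f where "f X = c (restrict (rank_block X s) {..<m})" for X
    have "f \<in> nsets {..<N} (m * s) \<rightarrow> {..<q}" using c by (simp add: f_def)
    then obtain i H where i: "i < q" and H: "H \<in> nsets {..<N} (m * M)"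
      and fi: "f ` nsets H (m * s) \<subseteq> {i}"
      using N unfolding partn_lst_def monochromatic_def by fastforce
    have finH: "finite H" and cH: "card H = m * M" and HN: "H \<subseteq> {..<N}"
      using H by (auto simp: nsets_def)
    have "c T = i" if T: "T \<in> PiE {..<m} (\<lambda>k. nsets (rank_block H M k) s)" for T
    proof -
      have Tk: "T k \<subseteq> rank_block H M k" "finite (T k) \<and> card (T k) = s" if "k < m" for k
        using T that by (auto simp: PiE_def Pi_def nsets_def)
      have less: "x < y" if "j < k" "k < m" "x \<in> T j" "y \<in> T k" for j k x y
        using rank_block_less[OF finH, of x M j y k] Tk(1)[of j] Tk(1)[of k] that by auto
      define X where "X = (\<Union>k<m. T k)"
      have "card X = m * s" and blk: "\<And>k. k < m \<Longrightarrow> rank_block X s k = T k"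
        using rank_block_Union[of s m T] assms(2) Tk(2) less unfolding X_def by blast+
      moreover have "X \<subseteq> H" using Tk(1) by (fastforce simp: X_def rank_block_def)
      ultimately have "X \<in> nsets H (m * s)"
        using finH by (auto simp: nsets_def intro: finite_subset)
      with fi have "f X = i" by auto
      moreover have "restrict (rank_block X s) {..<m} = T"
        using blk T by (intro ext) (auto simp: PiE_def extensional_def restrict_def)
      ultimately show ?thesis by (simp add: f_def)
    qed
    then show "\<exists>H. \<exists>i<q. (\<forall>k<m. H k \<subseteq> {..<N} \<and> card (H k) = M) \<and>
      (\<forall>T \<in> PiE {..<m} (\<lambda>k. nsets (H k) s). c T = i)"
      using i HN card_rank_block[OF finH cH assms(1)]
      by (intro exI[of _ "rank_block H M"] exI[of _ i]) (auto simp: rank_block_def)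
  qed
qed

section \<open>Helly theorem and centrepoints for locally finite midpoint sets\<close>

text \<open>Writing \<open>p\<close> as a combination of the midpoint and a point \<open>x\<close>
  of the hull of \<open>X\<close> puts \<open>p\<close> on both sides, on the right with weight
  \<open>u / 2 < 1\<close>. Solving for \<open>p\<close> leaves a convex combination of
  \<open>b\<close> and \<open>x\<close>.\<close>

lemma midpoint_hull_insert:
  fixes p b :: "'b::real_vector"
  assumes "b \<in> X" "p \<in> convex hull (insert (midpoint p b) X)"
  shows "p \<in> convex hull X"
proof -
  have "X \<noteq> {}" using assms(1) by auto
  then obtain u v x where uv: "0 \<le> u" "0 \<le> v" "u + v = 1" "x \<in> convex hull X"
    and p: "p = u *\<^sub>R midpoint p b + v *\<^sub>R x"
    using assms(2) unfolding convex_hull_insert[OF \<open>X \<noteq> {}\<close>] by blast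
  define c where "c = 1 - u / 2"
  have c: "0 < c" "u / 2 + v = c" using uv by (simp_all add: c_def)
  have mid: "u *\<^sub>R midpoint p b = (u / 2) *\<^sub>R p + (u / 2) *\<^sub>R b"
    by (simp add: midpoint_def scaleR_right_distrib)
  have p': "p = (u / 2) *\<^sub>R p + ((u / 2) *\<^sub>R b + v *\<^sub>R x)"
    using p unfolding mid add.assoc .
  have "c *\<^sub>R p = p - (u / 2) *\<^sub>R p"
    unfolding c_def scaleR_left_diff_distrib scaleR_one ..
  also have "\<dots> = (u / 2) *\<^sub>R p + ((u / 2) *\<^sub>R b + v *\<^sub>R x) - (u / 2) *\<^sub>R p"
    using p' by (rule arg_cong)
  finally have "c *\<^sub>R p = (u / 2) *\<^sub>R b + v *\<^sub>R x" by simp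
  from arg_cong[OF this, of "scaleR (inverse c)"]
  have "inverse c *\<^sub>R (c *\<^sub>R p) = (u / 2 / c) *\<^sub>R b + (v / c) *\<^sub>R x"
    unfolding scaleR_right_distrib scaleR_scaleR divide_inverse_commute[of _ c] .
  then have "p = (u / 2 / c) *\<^sub>R b + (v / c) *\<^sub>R x" using c(1) by simp
  also have "\<dots> \<in> convex hull X"
  proof (rule convexD[OF convex_convex_hull hull_inc[OF assms(1)] uv(4)])
    have "u / 2 / c + v / c = (u / 2 + v) / c" by (rule add_divide_distrib[symmetric])
    then show "u / 2 / c + v / c = 1" using c by simp
  qed (use uv c in simp_all)
  finally show ?thesis .
qed

text \<open>\<open>finite_hull\<close> is local finiteness in the form that makes the extremal
  choices below finite. The number \<open>h\<close> turns out to bound the Helly number of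
  \<open>S\<close>; it influences the final constant \<beta>, but not the size \<open>d + 1\<close>
  of the tuples.\<close>

locale midpoint_set =
  fixes S :: "'a::euclidean_space set" and h :: nat
  assumes h_pos: "0 < h"
    and finite_hull: "finite A \<Longrightarrow> A \<subseteq> S \<Longrightarrow> finite (S \<inter> convex hull A)"
    and midpoint: "finite A \<Longrightarrow> A \<subseteq> S \<Longrightarrow> h < card A \<Longrightarrow>
      \<exists>x\<in>A. \<exists>y\<in>A. x \<noteq> y \<and> midpoint x y \<in> S"
begin

definition meets :: "('i \<Rightarrow> 'a set) \<Rightarrow> 'i set \<Rightarrow> bool" where
  "meets F I \<longleftrightarrow> (\<exists>x\<in>S. \<forall>i\<in>I. x \<in> F i)"

text \<open>Restrict to the finitely many points of \<open>S\<close> in the hull of the witnesses \<open>w\<close> and enlarge the sets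
  as far as the common intersection stays empty (\<open>X\<close>). Choose \<open>p a\<close> in all \<open>X j\<close> with \<open>j \<noteq> a\<close>,
  as close to \<open>X a\<close> as possible. Two of the points \<open>p a\<close>, \<open>p b\<close> have their midpoint in \<open>S\<close>;
  were it outside \<open>X a\<close>, maximality and the choice of \<open>p a\<close> would force \<open>p a\<close> into \<open>X a\<close>.
  Hence the midpoint lies in every \<open>X j\<close>.\<close>

lemma helly_step:
  assumes "finite I" "h < card I" and conv: "\<And>i. i \<in> I \<Longrightarrow> convex (F i)"
    and proper: "\<And>i. i \<in> I \<Longrightarrow> meets F (I - {i})"
  shows "meets F I"
proof (rule ccontr)
  assume none: "\<not> meets F I"
  from proper have "\<forall>i\<in>I. \<exists>x. x \<in> S \<and> (\<forall>j\<in>I - {i}. x \<in> F j)"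
    unfolding meets_def by blast
  from bchoice[OF this] obtain w where "\<forall>i\<in>I. w i \<in> S \<and> (\<forall>j\<in>I - {i}. w i \<in> F j)" ..
  then have w: "\<And>i. i \<in> I \<Longrightarrow> w i \<in> S" "\<And>i j. i \<in> I \<Longrightarrow> j \<in> I - {i} \<Longrightarrow> w i \<in> F j"
    by blast+
  define S0 where "S0 = S \<inter> convex hull (w ` I)"
  have finS0: "finite S0"
    unfolding S0_def using assms(1) w(1) by (intro finite_hull) auto
  have w_S0: "w i \<in> S0" if "i \<in> I" for i
    using that w(1) by (auto simp: S0_def hull_inc)
  \<comment> \<open>The sets of a valid system are convex relative to \<open>S0\<close> and have no
    common point there, but retain the witnesses, so that any all but one of them still
    meet.\<close>
  define valid where "valid X \<longleftrightarrow> (\<forall>i\<in>I. X i \<subseteq> S0 \<and> S0 \<inter> convex hull (X i) \<subseteq> X i \<and> w ` (I - {i}) \<subseteq> X i)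
    \<and> (\<forall>x\<in>S0. \<exists>i\<in>I. x \<notin> X i)" for X
  have "valid (\<lambda>i. S0 \<inter> F i)"
    unfolding valid_def
  proof (intro conjI ballI)
    fix i assume i: "i \<in> I"
    have "convex hull (S0 \<inter> F i) \<subseteq> F i"
      using conv[OF i] by (intro hull_minimal) auto
    then show "S0 \<inter> convex hull (S0 \<inter> F i) \<subseteq> S0 \<inter> F i" by blast
    show "w ` (I - {i}) \<subseteq> S0 \<inter> F i" using w(2) w_S0 i by auto
  next
    fix x assume "x \<in> S0"
    then show "\<exists>i\<in>I. x \<notin> S0 \<inter> F i" using none by (auto simp: meets_def S0_def)
  qed simp
  moreover have "\<forall>X. valid X \<longrightarrow> (\<Sum>i\<in>I. card (X i)) < Suc (\<Sum>i\<in>I. card S0)"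
    using finS0 by (auto simp: valid_def less_Suc_eq_le intro!: sum_mono card_mono simp del: sum_constant)
  ultimately have "\<exists>X. valid X \<and> (\<forall>X'. valid X' \<longrightarrow> (\<Sum>i\<in>I. card (X' i)) \<le> (\<Sum>i\<in>I. card (X i)))"
    by (rule ex_has_greatest_nat)
  then obtain X where X: "valid X"
    and maximal: "\<forall>X'. valid X' \<longrightarrow> (\<Sum>i\<in>I. card (X' i)) \<le> (\<Sum>i\<in>I. card (X i))"
    by (elim exE conjE)
  have X_S0: "X i \<subseteq> S0" and X_conv: "S0 \<inter> convex hull (X i) \<subseteq> X i"
    and X_w: "w ` (I - {i}) \<subseteq> X i" if "i \<in> I" for i
    using X that by (auto simp: valid_def)
  have X_none: "\<exists>i\<in>I. x \<notin> X i" if "x \<in> S0" for x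
    using X that by (auto simp: valid_def)
  define A where "A a = {x \<in> S0. \<forall>j\<in>I - {a}. x \<in> X j}" for a
  have wA: "w a \<in> A a" if "a \<in> I" for a
    using that X_w w_S0 by (fastforce simp: A_def)
  have AX: "x \<notin> X a" if "a \<in> I" "x \<in> A a" for a x
    using X_none[of x] that by (auto simp: A_def)
  have finA: "finite (A a)" for a using finS0 by (simp add: A_def)
  \<comment> \<open>Closeness of \<open>p a\<close> to \<open>X a\<close> is measured by the number
    of points of \<open>A a\<close> in the hull of \<open>X a\<close> together with
    \<open>p a\<close>.\<close>
  have "\<forall>a\<in>I. \<exists>p. p \<in> A a \<and> (\<forall>r\<in>A a. card (A a \<inter> convex hull (insert p (X a)))
      \<le> card (A a \<inter> convex hull (insert r (X a))))"
  proof
    fix a assume "a \<in> I"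
    from wA[OF this] show "\<exists>p. p \<in> A a \<and> (\<forall>r\<in>A a. card (A a \<inter> convex hull (insert p (X a)))
        \<le> card (A a \<inter> convex hull (insert r (X a))))"
      using ex_has_least_nat[of "\<lambda>p. p \<in> A a" "w a" "\<lambda>p. card (A a \<inter> convex hull (insert p (X a)))"]
      by blast
  qed
  from bchoice[OF this] obtain p where
    "\<forall>a\<in>I. p a \<in> A a \<and> (\<forall>r\<in>A a. card (A a \<inter> convex hull (insert (p a) (X a)))
      \<le> card (A a \<inter> convex hull (insert r (X a))))" ..
  then have p: "\<And>a. a \<in> I \<Longrightarrow> p a \<in> A a"
    and p_min: "\<And>a r. a \<in> I \<Longrightarrow> r \<in> A a \<Longrightarrow> card (A a \<inter> convex hull (insert (p a) (X a)))
      \<le> card (A a \<inter> convex hull (insert r (X a)))" by blast+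
  have pX: "p a \<in> X b" if "a \<in> I" "b \<in> I" "a \<noteq> b" for a b
    using p[OF that(1)] that by (auto simp: A_def)
  have "inj_on p I"
    using pX AX p by (intro inj_onI) metis
  then have "h < card (p ` I)" using assms(2) by (simp add: card_image)
  moreover have "p ` I \<subseteq> S" using p by (auto simp: A_def S0_def)
  ultimately obtain a b where ab: "a \<in> I" "b \<in> I" "a \<noteq> b" and q: "midpoint (p a) (p b) \<in> S"
    using midpoint[of "p ` I"] assms(1) by auto
  have "midpoint (p a) (p b) \<in> convex hull (w ` I)"
    using p[OF ab(1)] p[OF ab(2)]
    by (intro midpoints_in_convex_hull) (auto simp: A_def S0_def)
  with q have q: "midpoint (p a) (p b) \<in> S0" by (simp add: S0_def)
  have in_X: "midpoint (p a) (p b) \<in> X a"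
    if ab: "a \<in> I" "b \<in> I" "a \<noteq> b" and q: "midpoint (p a) (p b) \<in> S0" for a b
  proof (rule ccontr)
    let ?q = "midpoint (p a) (p b)"
    assume nq: "?q \<notin> X a"
    \<comment> \<open>By maximality, enlarging \<open>X a\<close> by the midpoint breaks validity,
      and the only clause that can fail is the absence of a common point. Such a point
      \<open>r\<close> lies in \<open>A a\<close> and competes with \<open>p a\<close>.\<close>
    define X' where "X' = X(a := S0 \<inter> convex hull (insert ?q (X a)))"
    have sub: "X a \<subset> X' a"
      using X_S0[OF ab(1)] nq q by (auto simp: X'_def hull_inc)
    have "card (X a) < card (X' a)"
      using sub finS0 by (intro psubset_card_mono) (auto simp: X'_def)
    then have "(\<Sum>i\<in>I. card (X i)) < (\<Sum>i\<in>I. card (X' i))"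
      using assms(1) ab(1) by (intro sum_strict_mono_ex1) (auto simp: X'_def)
    with maximal[rule_format, of X'] have "\<not> valid X'" by auto
    moreover have "X' i \<subseteq> S0 \<and> S0 \<inter> convex hull (X' i) \<subseteq> X' i \<and> w ` (I - {i}) \<subseteq> X' i" if "i \<in> I" for i
    proof (cases "i = a")
      case True
      have "convex hull (X' a) \<subseteq> convex hull (insert ?q (X a))"
        by (intro hull_minimal) (auto simp: X'_def)
      then show ?thesis using True sub X_w[OF ab(1)] by (auto simp: X'_def)
    next
      case False
      then show ?thesis using X_S0 X_conv X_w that by (auto simp: X'_def)
    qed
    ultimately obtain r where r: "r \<in> S0" "\<And>i. i \<in> I \<Longrightarrow> r \<in> X' i"
      unfolding valid_def by blast
    have "r \<in> X j" if "j \<in> I" "j \<noteq> a" for j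
      using r(2)[OF that(1)] that(2) by (simp add: X'_def)
    then have rA: "r \<in> A a" using r(1) by (simp add: A_def)
    have rq: "r \<in> convex hull (insert ?q (X a))"
      using r(2)[OF ab(1)] by (simp add: X'_def)
    have pbX: "p b \<in> X a" using pX ab by auto
    have "?q \<in> convex hull (insert (p a) (X a))"
      using pbX by (intro midpoints_in_convex_hull) (auto simp: hull_inc)
    then have hq: "convex hull (insert ?q (X a)) \<subseteq> convex hull (insert (p a) (X a))"
      by (intro hull_minimal) (auto simp: hull_inc)
    have hr: "convex hull (insert r (X a)) \<subseteq> convex hull (insert ?q (X a))"
      using rq by (intro hull_minimal) (auto simp: hull_inc)
    \<comment> \<open>The hulls generated over \<open>X a\<close> by \<open>r\<close>, by the
      midpoint and by \<open>p a\<close> are increasing. By the choice of \<open>p a\<close> the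
      smallest and the largest contain the same points of \<open>A a\<close>, so \<open>p a\<close>
      lies in the smallest.\<close>
    have "A a \<inter> convex hull (insert r (X a)) = A a \<inter> convex hull (insert (p a) (X a))"
    proof (rule card_seteq[OF _ _ p_min[OF ab(1) rA]])
      show "finite (A a \<inter> convex hull (insert (p a) (X a)))" using finA by blast
      show "A a \<inter> convex hull (insert r (X a)) \<subseteq> A a \<inter> convex hull (insert (p a) (X a))"
        using hq hr by blast
    qed
    moreover have "p a \<in> A a \<inter> convex hull (insert (p a) (X a))"
      using p[OF ab(1)] by (simp add: hull_inc)
    ultimately have "p a \<in> convex hull (insert r (X a))" by blast
    with hr have "p a \<in> convex hull (insert ?q (X a))" by blast
    with pbX have "p a \<in> convex hull (X a)" by (rule midpoint_hull_insert)
    moreover have "p a \<in> S0" using p[OF ab(1)] by (simp add: A_def)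
    ultimately have "p a \<in> X a" using X_conv[OF ab(1)] by blast
    with AX[OF ab(1) p[OF ab(1)]] show False by simp
  qed
  have "midpoint (p a) (p b) \<in> X j" if j: "j \<in> I" for j
  proof -
    consider "j = a" | "j = b" | "j \<noteq> a" "j \<noteq> b" by blast
    then show ?thesis
    proof cases
      case 1
      then show ?thesis using in_X ab q by blast
    next
      case 2
      then show ?thesis using in_X[of b a] ab q by (simp add: midpoint_sym)
    next
      case 3
      then have "p a \<in> X j" "p b \<in> X j" using pX ab j by auto
      then have "midpoint (p a) (p b) \<in> convex hull (X j)"
        by (intro midpoints_in_convex_hull) (auto simp: hull_inc)
      then show ?thesis using q X_conv[OF j] by blast
    qed
  qed
  with X_none[OF q] show False by blast
qed

lemma helly:
  assumes "finite I" "\<And>i. i \<in> I \<Longrightarrow> convex (F i)"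
    and "\<And>J. J \<subseteq> I \<Longrightarrow> card J \<le> h \<Longrightarrow> meets F J"
  shows "meets F I"
  using assms
proof (induction I rule: finite_psubset_induct)
  case (psubset I)
  show ?case
  proof (cases "card I \<le> h")
    case True
    then show ?thesis using psubset.prems(2) by blast
  next
    case False
    show ?thesis
    proof (rule helly_step)
      show "finite I" "h < card I" using psubset.hyps False by simp_all
      show "convex (F i)" if "i \<in> I" for i using that by (rule psubset.prems(1))
      show "meets F (I - {i})" if "i \<in> I" for i
      proof (rule psubset.IH)
        show "I - {i} \<subset> I" using that by blast
        show "convex (F j)" if "j \<in> I - {i}" for j using that psubset.prems(1) by blast
        show "meets F J" if "J \<subseteq> I - {i}" "card J \<le> h" for J using that psubset.prems(2) by blast
      qed
    qed
  qed
qed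

text \<open>Helly's theorem is applied to the hulls of all subfamilies missing fewer than a fraction
  \<open>1 / h\<close> of the indices: the complements of \<open>h\<close> such subfamilies cannot
  cover \<open>Y\<close>. Indices are counted rather than points, since \<open>p\<close> need not be
  injective. A compact convex \<open>F\<close> missing \<open>c\<close> takes the place of the
  half-space, as this is the form in which the centrepoint is used.\<close>

lemma centrepoint:
  assumes "finite Y" "Y \<noteq> {}" "p ` Y \<subseteq> S"
  shows "\<exists>c\<in>S. \<forall>F. convex F \<and> compact F \<and> c \<notin> F \<longrightarrow>
    (\<exists>Z\<subseteq>Y. card Y \<le> h * card Z \<and> convex hull (p ` Z) \<inter> F = {})"
proof -
  define \<Z> where "\<Z> = {Z. Z \<subseteq> Y \<and> h * card (Y - Z) < card Y}"
  have "meets (\<lambda>Z. convex hull (p ` Z)) \<Z>"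
  proof (rule helly)
    show "finite \<Z>" using assms(1) by (simp add: \<Z>_def)
    show "convex (convex hull (p ` Z))" for Z by simp
    fix J assume J: "J \<subseteq> \<Z>" "card J \<le> h"
    have finJ: "finite J" using J(1) \<open>finite \<Z>\<close> finite_subset by blast
    have "\<exists>y\<in>Y. \<forall>Z\<in>J. y \<in> Z"
    proof (rule ccontr)
      assume "\<not> ?thesis"
      then have "Y \<subseteq> (\<Union>Z\<in>J. Y - Z)" by blast
      then have "card Y \<le> card (\<Union>Z\<in>J. Y - Z)"
        using finJ assms(1) by (intro card_mono) auto
      also have "\<dots> \<le> (\<Sum>Z\<in>J. card (Y - Z))" using finJ by (rule card_UN_le)
      finally have "h * card Y \<le> (\<Sum>Z\<in>J. h * card (Y - Z))"
        by (simp flip: sum_distrib_left)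
      \<comment> \<open>The strict inequality between integers saves one in each summand, which
        brings the total below \<open>h * card Y\<close>.\<close>
      also have "\<dots> \<le> (\<Sum>Z\<in>J. card Y - 1)"
        using J(1) by (intro sum_mono) (force simp: \<Z>_def)
      also have "\<dots> \<le> h * (card Y - 1)" using J(2) by simp
      also have "\<dots> < h * card Y" using h_pos assms(1,2) by (simp add: card_gt_0_iff)
      finally show False by simp
    qed
    then obtain y where "y \<in> Y" "\<forall>Z\<in>J. y \<in> Z" by blast
    then show "meets (\<lambda>Z. convex hull (p ` Z)) J"
      unfolding meets_def using assms(3) by (intro bexI[of _ "p y"]) (auto simp: hull_inc)
  qed
  then obtain c where c: "c \<in> S" "\<And>Z. Z \<in> \<Z> \<Longrightarrow> c \<in> convex hull (p ` Z)"
    unfolding meets_def by blast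
  show ?thesis
  proof (intro bexI[of _ c] c(1) allI impI)
    fix F assume F: "convex F \<and> compact F \<and> c \<notin> F"
    then obtain a b where ab: "a \<bullet> c < b" "\<forall>x\<in>F. b < a \<bullet> x"
      using separating_hyperplane_closed_point[of F c] compact_imp_closed by blast
    define Z where "Z = {y \<in> Y. a \<bullet> p y < b}"
    \<comment> \<open>If \<open>Z\<close> were smaller, \<open>Y - Z\<close> would belong to
      \<open>\<Z>\<close>, and its hull, lying beyond the hyperplane, would contain
      \<open>c\<close>.\<close>
    have "card Y \<le> h * card Z"
    proof (rule ccontr)
      assume "\<not> ?thesis"
      moreover have "Y - (Y - Z) = Z" by (auto simp: Z_def)
      ultimately have "Y - Z \<in> \<Z>" by (simp add: \<Z>_def)
      then have "c \<in> convex hull (p ` (Y - Z))" by (rule c(2))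
      also have "\<dots> \<subseteq> {x. a \<bullet> x \<ge> b}"
        by (intro hull_minimal convex_halfspace_ge) (auto simp: Z_def)
      finally show False using ab by simp
    qed
    moreover have "convex hull (p ` Z) \<subseteq> {x. a \<bullet> x < b}"
      by (intro hull_minimal convex_halfspace_lt) (auto simp: Z_def)
    ultimately show "\<exists>Z\<subseteq>Y. card Y \<le> h * card Z \<and> convex hull (p ` Z) \<inter> F = {}"
      using ab(2) by (intro exI[of _ Z]) (force simp: Z_def)
  qed
qed

end

section \<open>Intersecting transversals\<close>

text \<open>Linear dependence is a property of sets, so a repeated vector is treated separately,
  with the coefficients \<open>1\<close> and \<open>-1\<close>.\<close>

lemma linear_dependence_of_family:
  fixes a :: "nat \<Rightarrow> 'a::euclidean_space"
  assumes "DIM('a) < m"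
  shows "\<exists>l :: nat \<Rightarrow> real. (\<exists>i<m. l i \<noteq> 0) \<and> (\<Sum>i<m. l i *\<^sub>R a i) = 0"
proof (cases "inj_on a {..<m}")
  case True
  then have "dependent (a ` {..<m})"
    using assms by (intro dependent_biggerset) (simp add: card_image)
  then obtain u where u: "\<exists>v\<in>a ` {..<m}. u v \<noteq> 0" "(\<Sum>v\<in>a ` {..<m}. u v *\<^sub>R v) = 0"
    using dependent_finite[of "a ` {..<m}"] by auto
  then have "(\<Sum>i<m. u (a i) *\<^sub>R a i) = 0" using True by (simp add: sum.reindex)
  with u(1) show ?thesis by (intro exI[of _ "\<lambda>i. u (a i)"]) auto
next
  case False
  then obtain i j where ij: "i < m" "j < m" "i \<noteq> j" "a i = a j" by (auto simp: inj_on_def)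
  define l :: "nat \<Rightarrow> real" where "l k = (if k = i then 1 else if k = j then -1 else 0)" for k
  have "(\<Sum>k<m. l k *\<^sub>R a k) = (\<Sum>k\<in>{i, j}. l k *\<^sub>R a k)"
    using ij by (intro sum.mono_neutral_right) (auto simp: l_def)
  also have "\<dots> = 0" using ij by (simp add: l_def)
  finally show ?thesis using ij by (intro exI[of _ l]) (auto simp: l_def)
qed

text \<open>The functions \<open>x \<mapsto> a i \<bullet> x - b i\<close> defining \<open>m > DIM('a)\<close> separating hyperplanes have a
  nontrivial combination that is constant, yet all \<open>2 ^ m\<close> sign patterns occur.\<close>

lemma no_independent_splits:
  fixes p :: "nat set \<Rightarrow> 'a::euclidean_space"
  assumes m: "DIM('a) < m"
    and split: "\<And>i. i < m \<Longrightarrow> convex hull (p ` {A. A \<subseteq> {..<m} \<and> i \<in> A}) \<inter>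
      convex hull (p ` {A. A \<subseteq> {..<m} \<and> i \<notin> A}) = {}"
  shows False
proof -
  \<comment> \<open>A subset \<open>A\<close> of \<open>{..<m}\<close> stands for a sign pattern:
    \<open>p A\<close> is to lie below the \<open>i\<close>-th hyperplane exactly for
    \<open>i\<close> in \<open>A\<close>.\<close>
  have "\<exists>a b. \<forall>A. A \<subseteq> {..<m} \<longrightarrow> (i \<in> A \<longrightarrow> a \<bullet> p A < b) \<and> (i \<notin> A \<longrightarrow> b < a \<bullet> p A)"
    if i: "i < m" for i
  proof -
    let ?P = "p ` {A. A \<subseteq> {..<m} \<and> i \<in> A}" and ?Q = "p ` {A. A \<subseteq> {..<m} \<and> i \<notin> A}"
    have "{i} \<in> {A. A \<subseteq> {..<m} \<and> i \<in> A}" using i by simp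
    then have "convex hull ?P \<noteq> {}" by auto
    moreover have "compact (convex hull ?P)" "closed (convex hull ?Q)"
      by (simp_all add: finite_imp_compact_convex_hull compact_imp_closed)
    ultimately obtain a b where ab: "\<forall>x\<in>convex hull ?P. a \<bullet> x < b" "\<forall>x\<in>convex hull ?Q. b < a \<bullet> x"
      using separating_hyperplane_compact_closed[OF convex_convex_hull _ _ convex_convex_hull _ split[OF i]]
      by blast
    have "p A \<in> convex hull ?P" if "A \<subseteq> {..<m}" "i \<in> A" for A
      using that by (intro hull_inc) auto
    moreover have "p A \<in> convex hull ?Q" if "A \<subseteq> {..<m}" "i \<notin> A" for A
      using that by (intro hull_inc) auto
    ultimately show ?thesis using ab by (intro exI[of _ a] exI[of _ b]) auto
  qed
  then obtain a b where ab: "\<And>i A. i < m \<Longrightarrow> A \<subseteq> {..<m} \<Longrightarrow> i \<in> A \<Longrightarrow> a i \<bullet> p A < b i"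
      "\<And>i A. i < m \<Longrightarrow> A \<subseteq> {..<m} \<Longrightarrow> i \<notin> A \<Longrightarrow> b i < a i \<bullet> p A"
    by metis
  obtain l :: "nat \<Rightarrow> real" where l: "\<exists>i<m. l i \<noteq> 0" "(\<Sum>i<m. l i *\<^sub>R a i) = 0"
    using linear_dependence_of_family[OF m] by blast
  define f where "f A = (\<Sum>i<m. l i * (a i \<bullet> p A - b i))" for A
  have f: "f A = - (\<Sum>i<m. l i * b i)" for A
  proof -
    have "(\<Sum>i<m. l i * (a i \<bullet> p A)) = (\<Sum>i<m. l i *\<^sub>R a i) \<bullet> p A"
      by (simp add: inner_sum_left)
    then show ?thesis by (simp add: f_def l(2) right_diff_distrib sum_subtractf)
  qed
  obtain k where k: "k < m" "l k \<noteq> 0" using l(1) by blast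
  \<comment> \<open>At \<open>P\<close> every term of \<open>f\<close> is at most zero, at
    \<open>Q\<close> at least zero, strictly where \<open>l\<close> does not vanish. Hence
    \<open>f P < 0 < f Q\<close>, although \<open>f\<close> is constant.\<close>
  define P where "P = {i \<in> {..<m}. 0 < l i}"
  define Q where "Q = {i \<in> {..<m}. l i < 0}"
  have PQ: "P \<subseteq> {..<m}" "Q \<subseteq> {..<m}" by (auto simp: P_def Q_def)
  have P: "l i * (a i \<bullet> p P - b i) \<le> 0 \<and> (l i \<noteq> 0 \<longrightarrow> l i * (a i \<bullet> p P - b i) < 0)" if "i < m" for i
  proof (cases "0 < l i")
    case True
    then have "a i \<bullet> p P < b i" using ab(1)[OF that PQ(1)] that by (simp add: P_def)
    with True show ?thesis by (simp add: mult_pos_neg less_imp_le)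
  next
    case False
    then have "b i < a i \<bullet> p P" using ab(2)[OF that PQ(1)] by (simp add: P_def)
    with False show ?thesis by (auto simp: not_less mult_nonpos_nonneg intro: mult_neg_pos)
  qed
  have Q: "0 \<le> l i * (a i \<bullet> p Q - b i) \<and> (l i \<noteq> 0 \<longrightarrow> 0 < l i * (a i \<bullet> p Q - b i))" if "i < m" for i
  proof (cases "l i < 0")
    case True
    then have "a i \<bullet> p Q < b i" using ab(1)[OF that PQ(2)] that by (simp add: Q_def)
    with True show ?thesis by (simp add: mult_neg_neg less_imp_le)
  next
    case False
    then have "b i < a i \<bullet> p Q" using ab(2)[OF that PQ(2)] by (simp add: Q_def)
    with False show ?thesis by (auto simp: not_less)
  qed
  have "f P < (\<Sum>i<m. 0)"
    unfolding f_def using P k by (intro sum_strict_mono_ex1) auto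
  moreover have "(\<Sum>i<m. 0) < f Q"
    unfolding f_def using Q k by (intro sum_strict_mono_ex1) auto
  ultimately show False unfolding f by simp
qed

section \<open>From dense (d + 1)-tuples to \<open>h\<close> sets with a common point\<close>

context midpoint_set
begin

text \<open>If in some direction \<open>i\<close> the two faces of every \<open>2 \<times> \<dots> \<times> 2\<close> subgrid have intersecting hulls,
  then a centrepoint of a slice lies in the hulls of all parallel slices: a half-space at the
  centrepoint carries a positive fraction of the slice, hence a full \<open>2 \<times> \<dots> \<times> 2\<close> grid.
  Ramsey's theorem provides such a direction on large subgrids, as not all directions can be separated.\<close>
lemma grid_common_point:
  defines "m \<equiv> DIM('a) + 1"
  shows "\<exists>N. \<forall>p :: (nat \<Rightarrow> nat) \<Rightarrow> 'a. p ` PiE {..<m} (\<lambda>_. {..<N}) \<subseteq> S \<longrightarrow>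
    (\<exists>i<m. \<exists>J\<subseteq>{..<N}. card J = h \<and>
      (\<exists>c\<in>S. \<forall>j\<in>J. c \<in> convex hull (p ` {\<sigma> \<in> PiE {..<m} (\<lambda>_. {..<N}). \<sigma> i = j})))"
proof -
  have "\<forall>i. \<exists>R. \<forall>(V :: nat \<Rightarrow> nat set) E. (\<forall>k\<in>{..<m} - {i}. finite (V k) \<and> R \<le> card (V k)) \<longrightarrow>
    E \<subseteq> PiE ({..<m} - {i}) V \<longrightarrow> 1 / real h * (\<Prod>k\<in>{..<m} - {i}. card (V k)) \<le> card E \<longrightarrow>
    (\<exists>T. (\<forall>k\<in>{..<m} - {i}. T k \<subseteq> V k \<and> card (T k) = 2) \<and> PiE ({..<m} - {i}) T \<subseteq> E)"
    using h_pos by (intro allI dense_imp_grid) auto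
  from choice[OF this] obtain R where R:
    "\<forall>i. \<forall>(V :: nat \<Rightarrow> nat set) E. (\<forall>k\<in>{..<m} - {i}. finite (V k) \<and> R i \<le> card (V k)) \<longrightarrow>
      E \<subseteq> PiE ({..<m} - {i}) V \<longrightarrow> 1 / real h * (\<Prod>k\<in>{..<m} - {i}. card (V k)) \<le> card E \<longrightarrow>
      (\<exists>T. (\<forall>k\<in>{..<m} - {i}. T k \<subseteq> V k \<and> card (T k) = 2) \<and> PiE ({..<m} - {i}) T \<subseteq> E)" ..
  \<comment> \<open>\<open>M\<close> exceeds \<open>h\<close>, leaving room for a base slice and
    \<open>h\<close> further ones, and is at least every \<open>R i\<close>, as the density argument
    inside the base slice requires.\<close>
  define M where "M = Suc h + (\<Sum>i<m. R i)"
  have M: "0 < M" "h < M" by (simp_all add: M_def)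
  have RM: "R i \<le> M" if "i < m" for i
    using member_le_sum[of i "{..<m}" R] that by (simp add: M_def)
  obtain N where N: "\<forall>c :: (nat \<Rightarrow> nat set) \<Rightarrow> nat. (\<forall>T. c T < m) \<longrightarrow>
    (\<exists>H. \<exists>i<m. (\<forall>k<m. H k \<subseteq> {..<N} \<and> card (H k) = M) \<and>
      (\<forall>T \<in> PiE {..<m} (\<lambda>k. nsets (H k) 2). c T = i))"
    using product_ramsey[OF M(1), of 2 m m] by auto
  show ?thesis
  proof (rule exI[of _ N], intro allI impI)
    fix p :: "(nat \<Rightarrow> nat) \<Rightarrow> 'a"
    define G :: "(nat \<Rightarrow> nat) set" where "G = PiE {..<m} (\<lambda>_. {..<N})"
    assume "p ` PiE {..<m} (\<lambda>_. {..<N}) \<subseteq> S"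
    then have pS: "p \<sigma> \<in> S" if "\<sigma> \<in> G" for \<sigma> using that by (auto simp: G_def)
    have finG: "finite G" unfolding G_def by (intro finite_PiE) auto
    \<comment> \<open>No two faces of the box \<open>T\<close> that are orthogonal to direction
      \<open>i\<close> can be separated.\<close>
    define bad where "bad T i \<longleftrightarrow> (\<forall>u\<in>T i. \<forall>v\<in>T i. u \<noteq> v \<longrightarrow>
      convex hull (p ` {\<sigma> \<in> PiE {..<m} T. \<sigma> i = u}) \<inter>
      convex hull (p ` {\<sigma> \<in> PiE {..<m} T. \<sigma> i = v}) \<noteq> {})" for T i
    have ex_bad: "\<exists>i<m. bad T i" for T
    proof (rule ccontr)
      assume "\<not> ?thesis"
      then have "\<forall>i\<in>{..<m}. \<exists>uv. fst uv \<in> T i \<and> snd uv \<in> T i \<and>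
        convex hull (p ` {\<sigma> \<in> PiE {..<m} T. \<sigma> i = fst uv}) \<inter>
        convex hull (p ` {\<sigma> \<in> PiE {..<m} T. \<sigma> i = snd uv}) = {}"
        unfolding bad_def by fastforce
      from bchoice[OF this] obtain uv where "\<forall>i\<in>{..<m}. fst (uv i) \<in> T i \<and> snd (uv i) \<in> T i \<and>
        convex hull (p ` {\<sigma> \<in> PiE {..<m} T. \<sigma> i = fst (uv i)}) \<inter>
        convex hull (p ` {\<sigma> \<in> PiE {..<m} T. \<sigma> i = snd (uv i)}) = {}" ..
      then have uvT: "\<And>i. i < m \<Longrightarrow> fst (uv i) \<in> T i" "\<And>i. i < m \<Longrightarrow> snd (uv i) \<in> T i"
        and disj: "\<And>i. i < m \<Longrightarrow> convex hull (p ` {\<sigma> \<in> PiE {..<m} T. \<sigma> i = fst (uv i)}) \<inter>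
          convex hull (p ` {\<sigma> \<in> PiE {..<m} T. \<sigma> i = snd (uv i)}) = {}"
        by auto
      \<comment> \<open>\<open>\<sigma> A\<close> is the corner with sign pattern \<open>A\<close>
        of a box with two values in each direction. Were every direction separated, these corners
        would realise all patterns.\<close>
      define \<sigma> where "\<sigma> A = (\<lambda>k\<in>{..<m}. if k \<in> A then fst (uv k) else snd (uv k))" for A
      have \<sigma>: "\<sigma> A \<in> PiE {..<m} T" for A using uvT by (auto simp: \<sigma>_def)
      show False
      proof (rule no_independent_splits[of m "\<lambda>A. p (\<sigma> A)"])
        fix i assume i: "i < m"
        have "convex hull ((\<lambda>A. p (\<sigma> A)) ` {A. A \<subseteq> {..<m} \<and> i \<in> A}) \<subseteq>
          convex hull (p ` {\<sigma> \<in> PiE {..<m} T. \<sigma> i = fst (uv i)})"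
          using \<sigma> i by (intro hull_mono) (auto simp: \<sigma>_def)
        moreover have "convex hull ((\<lambda>A. p (\<sigma> A)) ` {A. A \<subseteq> {..<m} \<and> i \<notin> A}) \<subseteq>
          convex hull (p ` {\<sigma> \<in> PiE {..<m} T. \<sigma> i = snd (uv i)})"
          using \<sigma> i by (intro hull_mono) (auto simp: \<sigma>_def)
        ultimately show "convex hull ((\<lambda>A. p (\<sigma> A)) ` {A. A \<subseteq> {..<m} \<and> i \<in> A}) \<inter>
          convex hull ((\<lambda>A. p (\<sigma> A)) ` {A. A \<subseteq> {..<m} \<and> i \<notin> A}) = {}"
          using disj[OF i] by blast
      qed (simp add: m_def)
    qed
    \<comment> \<open>The inseparable direction serves as the colour of a box, so that Ramsey's
      theorem makes it the same for all boxes of side two in a large grid.\<close>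
    define c where "c T = (SOME i. i < m \<and> bad T i)" for T
    have c: "c T < m \<and> bad T (c T)" for T
      unfolding c_def by (rule someI_ex) (rule ex_bad)
    obtain H i where i: "i < m" and H: "\<And>k. k < m \<Longrightarrow> H k \<subseteq> {..<N}" "\<And>k. k < m \<Longrightarrow> card (H k) = M"
      and cH: "\<And>T. T \<in> PiE {..<m} (\<lambda>k. nsets (H k) 2) \<Longrightarrow> c T = i"
      using N[rule_format, of c] c by blast
    have finH: "finite (H k)" if "k < m" for k
      using H(2)[OF that] M(1) card.infinite by fastforce
    define K where "K = {..<m} - {i}"
    \<comment> \<open>\<open>s\<close> selects the base slice whose centrepoint is taken. Its points
      are indexed by functions on \<open>K\<close>, with the coordinate \<open>i\<close> filled in
      as \<open>s\<close>.\<close>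
    obtain s where s: "s \<in> H i" using H(2)[OF i] M(1) by fastforce
    have cHs: "card (H i - {s}) = M - 1" using s H(2)[OF i] by simp
    define Y where "Y = PiE K H"
    have finY: "finite Y" and cY: "card Y = (\<Prod>k\<in>K. card (H k))"
      using finH by (auto simp: Y_def K_def card_PiE intro!: finite_PiE)
    have "card Y \<noteq> 0" unfolding cY using H(2) M(1) by (auto simp: K_def)
    then have Y0: "Y \<noteq> {}" by auto
    have upd: "\<rho>(i := s) \<in> G" if "\<rho> \<in> Y" for \<rho>
    proof -
      have 1: "\<rho> k \<in> H k" if "k < m" "k \<noteq> i" for k
        using PiE_mem[OF \<open>\<rho> \<in> Y\<close>[unfolded Y_def], of k] that by (simp add: K_def)
      have 2: "\<rho> k = undefined" if "\<not> k < m" for k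
        using PiE_arb[OF \<open>\<rho> \<in> Y\<close>[unfolded Y_def], of k] that by (simp add: K_def)
      show ?thesis
        unfolding G_def
      proof (rule PiE_I)
        fix k assume "k \<in> {..<m}"
        then show "(\<rho>(i := s)) k \<in> {..<N}"
          using 1[of k] H(1)[of k] s by (cases "k = i") auto
      qed (use 2 i in auto)
    qed
    obtain z where z: "z \<in> S" "\<And>F. convex F \<and> compact F \<and> z \<notin> F \<Longrightarrow>
      (\<exists>Z\<subseteq>Y. card Y \<le> h * card Z \<and> convex hull ((\<lambda>\<rho>. p (\<rho>(i := s))) ` Z) \<inter> F = {})"
      using centrepoint[OF finY Y0, of "\<lambda>\<rho>. p (\<rho>(i := s))"] upd pS by blast
    define F where "F j = convex hull (p ` {\<sigma> \<in> G. \<sigma> i = j})" for j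
    have "z \<in> F f" if f: "f \<in> H i - {s}" for f
    proof (rule ccontr)
      assume "z \<notin> F f"
      moreover have "compact (F f)" "convex (F f)"
        using finG by (simp_all add: F_def finite_imp_compact_convex_hull)
      ultimately obtain Z where Z: "Z \<subseteq> Y" "card Y \<le> h * card Z"
        "convex hull ((\<lambda>\<rho>. p (\<rho>(i := s))) ` Z) \<inter> F f = {}"
        using z(2) by blast
      have "real (card Y) \<le> real h * card Z" using Z(2) by (simp flip: of_nat_mult)
      then have "1 / real h * (\<Prod>k\<in>K. card (H k)) \<le> card Z"
        using h_pos cY by (simp add: pos_divide_le_eq mult.commute)
      moreover have "\<forall>k\<in>K. finite (H k) \<and> R i \<le> card (H k)"
        using finH H(2) RM[OF i] by (simp add: K_def)
      moreover have "Z \<subseteq> PiE K H" using Z(1) by (simp add: Y_def)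
      ultimately have "\<exists>T0. (\<forall>k\<in>K. T0 k \<subseteq> H k \<and> card (T0 k) = 2) \<and> PiE K T0 \<subseteq> Z"
        using R[THEN spec[of _ i], THEN spec[of _ H], THEN spec[of _ Z]] unfolding K_def[symmetric]
        by (elim impE)
      then obtain T0 where T0: "\<And>k. k \<in> K \<Longrightarrow> T0 k \<subseteq> H k" "\<And>k. k \<in> K \<Longrightarrow> card (T0 k) = 2"
        "PiE K T0 \<subseteq> Z"
        by blast
      \<comment> \<open>The grid \<open>T0\<close> of the base slice lies in \<open>Z\<close>, whose
        hull misses \<open>F f\<close>. With its parallel copy over \<open>f\<close> it forms a box
        of colour \<open>i\<close>, so the hulls of these two faces meet; but one is inside the hull
        of \<open>Z\<close> and the other inside \<open>F f\<close>.\<close>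
      define T where "T = (\<lambda>k\<in>{..<m}. if k = i then {f, s} else T0 k)"
      have Tk: "T k = T0 k" "k \<in> K" if "k < m" "k \<noteq> i" for k using that by (simp_all add: T_def K_def)
      have Ti: "T i = {f, s}" using i by (simp add: T_def)
      have TH: "T k \<subseteq> H k \<and> card (T k) = 2" if "k < m" for k
        using that T0 Tk Ti f s by (cases "k = i") auto
      have "T \<in> PiE {..<m} (\<lambda>k. nsets (H k) 2)"
      proof (rule PiE_I)
        fix k assume "k \<in> {..<m}"
        then show "T k \<in> nsets (H k) 2"
          using TH[of k] finH[of k] by (auto simp: nsets_def intro: finite_subset)
      qed (simp add: T_def)
      then have "bad T i" using cH c[of T] by metis
      then have meet: "convex hull (p ` {\<sigma> \<in> PiE {..<m} T. \<sigma> i = f}) \<inter>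
        convex hull (p ` {\<sigma> \<in> PiE {..<m} T. \<sigma> i = s}) \<noteq> {}"
        unfolding bad_def Ti using f by blast
      have "PiE {..<m} T \<subseteq> G"
        unfolding G_def using TH H(1) by (intro PiE_mono) blast
      then have 1: "convex hull (p ` {\<sigma> \<in> PiE {..<m} T. \<sigma> i = f}) \<subseteq> F f"
        unfolding F_def by (intro hull_mono) blast
      have "p \<sigma> \<in> (\<lambda>\<rho>. p (\<rho>(i := s))) ` Z" if \<sigma>: "\<sigma> \<in> PiE {..<m} T" "\<sigma> i = s" for \<sigma>
      proof -
        have "\<sigma>(i := undefined) \<in> PiE K T0"
        proof (rule PiE_I)
          fix k assume "k \<in> K"
          then show "(\<sigma>(i := undefined)) k \<in> T0 k"
            using PiE_mem[OF \<sigma>(1), of k] Tk(1)[of k] by (simp add: K_def)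
        next
          fix k assume "k \<notin> K"
          then show "(\<sigma>(i := undefined)) k = undefined"
            using PiE_arb[OF \<sigma>(1), of k] by (auto simp: K_def)
        qed
        with T0(3) have "\<sigma>(i := undefined) \<in> Z" by blast
        moreover have "p \<sigma> = p ((\<sigma>(i := undefined))(i := s))"
          using \<sigma>(2) by (metis fun_upd_triv fun_upd_upd)
        ultimately show ?thesis by blast
      qed
      then have "convex hull (p ` {\<sigma> \<in> PiE {..<m} T. \<sigma> i = s}) \<subseteq>
        convex hull ((\<lambda>\<rho>. p (\<rho>(i := s))) ` Z)"
        by (intro hull_mono) blast
      with 1 meet Z(3) show False by blast
    qed
    moreover have "h \<le> card (H i - {s})" using cHs M(2) by simp
    then obtain J where "J \<subseteq> H i - {s}" "card J = h"
      by (rule obtain_subset_with_card_n)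
    ultimately show "\<exists>i<m. \<exists>J\<subseteq>{..<N}. card J = h \<and>
      (\<exists>c\<in>S. \<forall>j\<in>J. c \<in> convex hull (p ` {\<sigma> \<in> PiE {..<m} (\<lambda>_. {..<N}). \<sigma> i = j}))"
      using i z(1) H(1)[OF i] unfolding F_def G_def
      by (intro exI[of _ i] conjI exI[of _ J] bexI[of _ z]) auto
  qed
qed

text \<open>The ordered \<open>m\<close>-tuples meeting in \<open>S\<close> have positive density,
  hence contain all transversals of large classes. Witnesses for the transversals form a grid of
  points of \<open>S\<close>. All witnesses in slice \<open>j\<close> of direction \<open>i\<close>
  lie in the one convex set \<open>F (e i j)\<close>, so a point common to the hulls of
  \<open>h\<close> slices lies in \<open>h\<close> sets.\<close>

lemma dense_imp_meets:
  fixes \<alpha> :: real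
  defines "m \<equiv> DIM('a) + 1"
  assumes "0 < \<alpha>"
  shows "\<exists>N\<ge>m + h. \<forall>A (F :: nat \<Rightarrow> 'a set). finite A \<longrightarrow> card A = N \<longrightarrow> (\<forall>i\<in>A. convex (F i)) \<longrightarrow>
    \<alpha> * (N choose m) \<le> card {I. I \<subseteq> A \<and> card I = m \<and> meets F I} \<longrightarrow>
    (\<exists>J\<subseteq>A. card J = h \<and> meets F J)"
proof -
  obtain t where t: "\<forall>p :: (nat \<Rightarrow> nat) \<Rightarrow> 'a. p ` PiE {..<m} (\<lambda>_. {..<t}) \<subseteq> S \<longrightarrow>
    (\<exists>i<m. \<exists>J\<subseteq>{..<t}. card J = h \<and>
      (\<exists>c\<in>S. \<forall>j\<in>J. c \<in> convex hull (p ` {\<sigma> \<in> PiE {..<m} (\<lambda>_. {..<t}). \<sigma> i = j})))"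
    using grid_common_point unfolding m_def by blast
  have m: "0 < m" by (simp add: m_def)
  \<comment> \<open>The factor \<open>m ^ m\<close> comes from
    \<open>(N / m) ^ m <= N choose m\<close>, which compares the number of sets with the number of
    tuples.\<close>
  have "\<exists>R. \<forall>(V :: nat \<Rightarrow> nat set) E. (\<forall>k\<in>{..<m}. finite (V k) \<and> R \<le> card (V k)) \<longrightarrow>
    E \<subseteq> PiE {..<m} V \<longrightarrow> \<alpha> / real m ^ m * (\<Prod>k<m. card (V k)) \<le> card E \<longrightarrow>
    (\<exists>T. (\<forall>k\<in>{..<m}. T k \<subseteq> V k \<and> card (T k) = t) \<and> PiE {..<m} T \<subseteq> E)"
    using assms m by (intro dense_imp_grid) auto
  then obtain R where R: "\<forall>(V :: nat \<Rightarrow> nat set) E. (\<forall>k\<in>{..<m}. finite (V k) \<and> R \<le> card (V k)) \<longrightarrow>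
    E \<subseteq> PiE {..<m} V \<longrightarrow> \<alpha> / real m ^ m * (\<Prod>k<m. card (V k)) \<le> card E \<longrightarrow>
    (\<exists>T. (\<forall>k\<in>{..<m}. T k \<subseteq> V k \<and> card (T k) = t) \<and> PiE {..<m} T \<subseteq> E)" ..
  define N where "N = max R (m + h)"
  show ?thesis
  proof (intro exI[of _ N] conjI allI impI)
    show "m + h \<le> N" by (simp add: N_def)
    fix A and F :: "nat \<Rightarrow> 'a set"
    assume A: "finite A" "card A = N" and conv: "\<forall>i\<in>A. convex (F i)"
      and dens: "\<alpha> * (N choose m) \<le> card {I. I \<subseteq> A \<and> card I = m \<and> meets F I}"
    define E where "E = {\<sigma> \<in> PiE {..<m} (\<lambda>_. A). meets F (\<sigma> ` {..<m})}"
    have finE: "finite E" using A by (auto simp: E_def intro!: finite_PiE)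
    have "{I. I \<subseteq> A \<and> card I = m \<and> meets F I} \<subseteq> (\<lambda>\<sigma>. \<sigma> ` {..<m}) ` E"
    proof
      fix I assume I: "I \<in> {I. I \<subseteq> A \<and> card I = m \<and> meets F I}"
      then have "finite I" using A finite_subset by blast
      then obtain \<sigma> where "bij_betw \<sigma> {0..<m} I" using ex_bij_betw_nat_finite I by blast
      then have "restrict \<sigma> {..<m} ` {..<m} = I" by (simp add: bij_betw_def atLeast0LessThan)
      moreover from this have "restrict \<sigma> {..<m} \<in> E"
        using I unfolding E_def by (auto simp: PiE_def Pi_def image_subset_iff)
      ultimately show "I \<in> (\<lambda>\<sigma>. \<sigma> ` {..<m}) ` E" by blast
    qed
    then have "card {I. I \<subseteq> A \<and> card I = m \<and> meets F I} \<le> card E"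
      using finE by (meson card_image_le card_mono finite_imageI order_trans)
    moreover have "\<alpha> * (real N / real m) ^ m \<le> \<alpha> * (N choose m)"
      using assms(2) by (intro mult_left_mono binomial_ge_n_over_k_pow_k) (simp_all add: N_def)
    ultimately have "\<alpha> * (real N / real m) ^ m \<le> card E" using dens by linarith
    then have "\<alpha> / real m ^ m * (\<Prod>k<m. card A) \<le> card E"
      by (simp add: A(2) power_divide)
    moreover have "\<forall>k\<in>{..<m}. finite A \<and> R \<le> card A" using A by (simp add: N_def)
    moreover have "E \<subseteq> PiE {..<m} (\<lambda>_. A)" by (auto simp: E_def)
    ultimately have "\<exists>T. (\<forall>k\<in>{..<m}. T k \<subseteq> A \<and> card (T k) = t) \<and> PiE {..<m} T \<subseteq> E"
      using R[THEN spec[of _ "\<lambda>_. A"], THEN spec[of _ E]] by (elim impE)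
    then obtain T where T: "\<forall>k\<in>{..<m}. T k \<subseteq> A \<and> card (T k) = t" and TE: "PiE {..<m} T \<subseteq> E"
      by blast
    have "\<forall>k\<in>{..<m}. \<exists>e. bij_betw e {..<t} (T k)"
    proof
      fix k assume "k \<in> {..<m}"
      then have "finite (T k)" "card (T k) = t" using T A finite_subset by blast+
      then show "\<exists>e. bij_betw e {..<t} (T k)"
        using ex_bij_betw_nat_finite[of "T k"] by (simp add: atLeast0LessThan)
    qed
    from bchoice[OF this] obtain e where e: "\<forall>k\<in>{..<m}. bij_betw (e k) {..<t} (T k)" ..
    have eT: "e k j \<in> T k" if "k < m" "j < t" for k j
      using e that by (auto simp: bij_betw_def)
    define G :: "(nat \<Rightarrow> nat) set" where "G = PiE {..<m} (\<lambda>_. {..<t})"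
    have "\<forall>\<sigma>\<in>G. \<exists>x. x \<in> S \<and> (\<forall>k<m. x \<in> F (e k (\<sigma> k)))"
    proof
      fix \<sigma> assume \<sigma>: "\<sigma> \<in> G"
      have "\<sigma> k < t" if "k < m" for k using PiE_mem[OF \<sigma>[unfolded G_def], of k] that by simp
      then have "(\<lambda>k\<in>{..<m}. e k (\<sigma> k)) \<in> PiE {..<m} T" using eT by auto
      then have "meets F ((\<lambda>k\<in>{..<m}. e k (\<sigma> k)) ` {..<m})"
        using TE unfolding E_def by blast
      then show "\<exists>x. x \<in> S \<and> (\<forall>k<m. x \<in> F (e k (\<sigma> k)))" by (auto simp: meets_def)
    qed
    from bchoice[OF this] obtain p where p: "\<forall>\<sigma>\<in>G. p \<sigma> \<in> S \<and> (\<forall>k<m. p \<sigma> \<in> F (e k (\<sigma> k)))" ..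
    then have "p ` PiE {..<m} (\<lambda>_. {..<t}) \<subseteq> S" by (auto simp: G_def)
    with t obtain i J c where i: "i < m" and J: "J \<subseteq> {..<t}" "card J = h" and c: "c \<in> S"
      and cJ: "\<forall>j\<in>J. c \<in> convex hull (p ` {\<sigma> \<in> G. \<sigma> i = j})"
      unfolding G_def by blast
    have Ti: "T i \<subseteq> A" using T i by auto
    have "c \<in> F (e i j)" if j: "j \<in> J" for j
    proof -
      have "e i j \<in> A" using j J(1) eT[OF i] Ti by blast
      then have "convex hull (p ` {\<sigma> \<in> G. \<sigma> i = j}) \<subseteq> F (e i j)"
        using conv p i by (intro hull_minimal) auto
      then show ?thesis using cJ j by blast
    qed
    then have "meets F (e i ` J)" unfolding meets_def using c by blast
    moreover have "card (e i ` J) = h"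
    proof -
      have "inj_on (e i) J" using e i J(1) by (auto simp: bij_betw_def intro: inj_on_subset)
      then show ?thesis using J(2) by (simp add: card_image)
    qed
    moreover have "e i ` J \<subseteq> A" using eT[OF i] J(1) Ti by blast
    ultimately show "\<exists>J\<subseteq>A. card J = h \<and> meets F J" by blast
  qed
qed

end

section \<open>Fractional Helly theorem\<close>

lemma card_supersets:
  assumes "finite V" "I \<subseteq> V" "card I = k" "k \<le> N"
  shows "card {A. A \<subseteq> V \<and> card A = N \<and> I \<subseteq> A} = (card V - k) choose (N - k)"
proof -
  have finI: "finite I" using assms finite_subset by blast
  have "bij_betw (\<lambda>B. B \<union> I) {B. B \<subseteq> V - I \<and> card B = N - k} {A. A \<subseteq> V \<and> card A = N \<and> I \<subseteq> A}"
  proof (rule bij_betw_byWitness[where f' = "\<lambda>A. A - I"])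
    show "(\<lambda>B. B \<union> I) ` {B. B \<subseteq> V - I \<and> card B = N - k} \<subseteq> {A. A \<subseteq> V \<and> card A = N \<and> I \<subseteq> A}"
    proof clarify
      fix B assume B: "B \<subseteq> V - I" "card B = N - k"
      then have "card (B \<union> I) = card B + card I"
        using assms(1) finI by (intro card_Un_disjoint) (auto intro: finite_subset)
      then show "B \<union> I \<subseteq> V \<and> card (B \<union> I) = N \<and> I \<subseteq> B \<union> I" using B assms by auto
    qed
    show "(\<lambda>A. A - I) ` {A. A \<subseteq> V \<and> card A = N \<and> I \<subseteq> A} \<subseteq> {B. B \<subseteq> V - I \<and> card B = N - k}"
      using finI assms(3) by (auto simp: card_Diff_subset)
  qed auto
  then have "card {A. A \<subseteq> V \<and> card A = N \<and> I \<subseteq> A} = card {B. B \<subseteq> V - I \<and> card B = N - k}"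
    by (simp add: bij_betw_same_card)
  also have "\<dots> = (card V - k) choose (N - k)"
    using assms finI by (simp add: n_subsets card_Diff_subset)
  finally show ?thesis .
qed

text \<open>Both sides count the pairs of an \<open>I\<close> and an \<open>N\<close>-set containing
  it.\<close>

lemma sum_card_subsets:
  assumes "finite V" "k \<le> N"
  shows "(\<Sum>A | A \<subseteq> V \<and> card A = N. card {I. I \<subseteq> A \<and> card I = k \<and> P I}) =
    card {I. I \<subseteq> V \<and> card I = k \<and> P I} * ((card V - k) choose (N - k))"
proof -
  let ?\<A> = "{A. A \<subseteq> V \<and> card A = N}" and ?\<I> = "{I. I \<subseteq> V \<and> card I = k \<and> P I}"
  have "card {I. I \<subseteq> A \<and> card I = k \<and> P I} = (\<Sum>I | I \<in> ?\<I> \<and> I \<subseteq> A. 1)" if "A \<in> ?\<A>" for A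
  proof -
    have "{I. I \<subseteq> A \<and> card I = k \<and> P I} = {I. I \<in> ?\<I> \<and> I \<subseteq> A}" using that by auto
    then show ?thesis by simp
  qed
  then have "(\<Sum>A\<in>?\<A>. card {I. I \<subseteq> A \<and> card I = k \<and> P I}) = (\<Sum>A\<in>?\<A>. \<Sum>I | I \<in> ?\<I> \<and> I \<subseteq> A. 1)"
    by (rule sum.cong[OF refl])
  also have "\<dots> = (\<Sum>I\<in>?\<I>. \<Sum>A | A \<in> ?\<A> \<and> I \<subseteq> A. 1)"
    using assms(1) by (intro sum.swap_restrict) auto
  also have "\<dots> = (\<Sum>I\<in>?\<I>. (card V - k) choose (N - k))"
  proof (rule sum.cong[OF refl])
    fix I assume "I \<in> ?\<I>"
    then show "(\<Sum>A | A \<in> ?\<A> \<and> I \<subseteq> A. 1) = (card V - k) choose (N - k)"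
      using card_supersets[of V I k N] assms by (simp add: conj_assoc)
  qed
  finally show ?thesis by simp
qed

text \<open>Averaged over the \<open>N\<close>-sets, the density of \<open>P\<close> is at least
  \<alpha>, so a fraction \<open>\<alpha> / 2\<close> of them have local density at least
  \<open>\<alpha> / 2\<close>. Each of these contains an \<open>h\<close>-set with \<open>Q\<close>,
  and an \<open>h\<close>-set lies in only \<open>(card V - h) choose (N - h)\<close> of the
  \<open>N\<close>-sets.\<close>

lemma subset_density_lift:
  fixes \<alpha> :: real
  assumes \<alpha>: "0 < \<alpha>" and V: "finite V" "N \<le> card V" and kN: "k \<le> N" "h \<le> N"
    and dens: "\<alpha> * (card V choose k) \<le> card {I. I \<subseteq> V \<and> card I = k \<and> P I}"
    and local: "\<And>A. A \<subseteq> V \<Longrightarrow> card A = N \<Longrightarrow>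
      \<alpha> / 2 * (N choose k) \<le> card {I. I \<subseteq> A \<and> card I = k \<and> P I} \<Longrightarrow> \<exists>J\<subseteq>A. card J = h \<and> Q J"
  shows "\<alpha> / 2 * (card V choose h) \<le> (N choose h) * card {J. J \<subseteq> V \<and> card J = h \<and> Q J}"
proof -
  let ?n = "card V"
  define \<A> where "\<A> = {A. A \<subseteq> V \<and> card A = N}"
  define e where "e A = card {I. I \<subseteq> A \<and> card I = k \<and> P I}" for A
  define q where "q A = card {J. J \<subseteq> A \<and> card J = h \<and> Q J}" for A
  define \<G> where "\<G> = {A \<in> \<A>. \<alpha> / 2 * (N choose k) \<le> e A}"
  have fin: "finite \<A>" using V by (simp add: \<A>_def)
  have card\<A>: "card \<A> = ?n choose N" using V by (simp add: \<A>_def n_subsets)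
  have e_le: "e A \<le> N choose k" if "A \<in> \<A>" for A
  proof -
    have "finite A" using that V finite_subset by (auto simp: \<A>_def)
    then have "e A \<le> card {I. I \<subseteq> A \<and> card I = k}" unfolding e_def by (intro card_mono) auto
    then show ?thesis using \<open>finite A\<close> that by (simp add: n_subsets \<A>_def)
  qed
  have "\<alpha> * ((?n choose N) * (N choose k)) = \<alpha> * (?n choose k) * ((?n - k) choose (N - k))"
    unfolding choose_mult[OF kN(1) V(2)] by simp
  also have "\<dots> \<le> card {I. I \<subseteq> V \<and> card I = k \<and> P I} * ((?n - k) choose (N - k))"
    unfolding of_nat_mult using dens by (intro mult_right_mono) auto
  also have "\<dots> = (\<Sum>A\<in>\<A>. e A)"
    using sum_card_subsets[OF V(1) kN(1), of P] by (simp add: \<A>_def e_def)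
  also have "\<dots> = (\<Sum>A\<in>\<G>. real (e A)) + (\<Sum>A\<in>\<A> - \<G>. real (e A))"
    using fin by (simp add: \<G>_def sum.subset_diff[of \<G> \<A>] flip: of_nat_sum)
  also have "\<dots> \<le> (\<Sum>A\<in>\<G>. real (N choose k)) + (\<Sum>A\<in>\<A> - \<G>. \<alpha> / 2 * (N choose k))"
    using e_le by (intro add_mono sum_mono) (auto simp: \<G>_def)
  also have "\<dots> = card \<G> * (N choose k) + card (\<A> - \<G>) * (\<alpha> / 2 * (N choose k))" by simp
  also have "\<dots> \<le> card \<G> * (N choose k) + (?n choose N) * (\<alpha> / 2 * (N choose k))"
    using card_mono[OF fin, of "\<A> - \<G>"] \<alpha>
    by (intro add_left_mono mult_right_mono) (auto simp: card\<A>)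
  finally have "\<alpha> / 2 * (?n choose N) * (N choose k) \<le> card \<G> * (N choose k)"
    by (simp add: algebra_simps)
  then have \<G>: "\<alpha> / 2 * (?n choose N) \<le> card \<G>" using kN(1) by simp
  have "card \<G> = (\<Sum>A\<in>\<G>. 1)" by simp
  also have "\<dots> \<le> (\<Sum>A\<in>\<G>. q A)"
  proof (rule sum_mono)
    fix A assume A: "A \<in> \<G>"
    then have "\<exists>J\<subseteq>A. card J = h \<and> Q J" by (intro local) (auto simp: \<G>_def \<A>_def e_def)
    moreover have "finite A" using A V finite_subset by (auto simp: \<G>_def \<A>_def)
    ultimately show "1 \<le> q A" by (auto simp: q_def Suc_le_eq card_gt_0_iff)
  qed
  also have "\<dots> \<le> (\<Sum>A\<in>\<A>. q A)" using fin by (intro sum_mono2) (auto simp: \<G>_def)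
  also have "\<dots> = card {J. J \<subseteq> V \<and> card J = h \<and> Q J} * ((?n - h) choose (N - h))"
    using sum_card_subsets[OF V(1) kN(2), of Q] by (simp add: \<A>_def q_def)
  finally have "real (card \<G>) \<le>
      real (card {J. J \<subseteq> V \<and> card J = h \<and> Q J}) * real ((?n - h) choose (N - h))"
    unfolding of_nat_mult[symmetric] by (rule of_nat_mono)
  with \<G> have "\<alpha> / 2 * (?n choose N) \<le>
      real (card {J. J \<subseteq> V \<and> card J = h \<and> Q J}) * real ((?n - h) choose (N - h))"
    by (rule order_trans)
  then have "\<alpha> / 2 * (?n choose N) * real (N choose h) \<le>
      real (card {J. J \<subseteq> V \<and> card J = h \<and> Q J}) * real ((?n - h) choose (N - h)) * real (N choose h)"
    by (rule mult_right_mono) simp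
  moreover have "real (?n choose N) * real (N choose h) = real (?n choose h) * real ((?n - h) choose (N - h))"
    using choose_mult[OF kN(2) V(2)] by (metis of_nat_mult)
  ultimately have "(\<alpha> / 2 * real (?n choose h)) * real ((?n - h) choose (N - h)) \<le>
      (real (N choose h) * card {J. J \<subseteq> V \<and> card J = h \<and> Q J}) * real ((?n - h) choose (N - h))"
    by (simp add: mult_ac)
  moreover have "0 < real ((?n - h) choose (N - h))" using V(2) kN(2) by simp
  ultimately have "\<alpha> / 2 * real (?n choose h) \<le>
      real (N choose h) * card {J. J \<subseteq> V \<and> card J = h \<and> Q J}"
    by (rule mult_right_le_imp_le)
  then show ?thesis by simp
qed

text \<open>Such a functional makes lowest points of finite sets unique. To make it nonzero on one
  more vector \<open>v\<close>, a multiple of \<open>v\<close> is added whose coefficient avoids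
  finitely many values.\<close>

lemma generic_functional:
  fixes D :: "'a::euclidean_space set"
  assumes "finite D"
  shows "\<exists>a. inj_on (\<lambda>x. a \<bullet> x) D"
proof -
  have avoid: "\<exists>a. \<forall>v\<in>E. a \<bullet> v \<noteq> 0" if "finite E" "0 \<notin> E" for E :: "'a set"
    using that
  proof (induction E rule: finite_induct)
    case (insert v E)
    then obtain a where a: "\<forall>w\<in>E. a \<bullet> w \<noteq> 0" by auto
    have v: "v \<bullet> v \<noteq> 0" using insert.prems by simp
    define X where "X = insert (- (a \<bullet> v) / (v \<bullet> v)) ((\<lambda>w. - (a \<bullet> w) / (v \<bullet> w)) ` E)"
    have "finite X" using insert.hyps by (simp add: X_def)
    then obtain t where t: "t \<notin> X" using ex_new_if_finite infinite_UNIV_char_0 by blast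
    have "(a + t *\<^sub>R v) \<bullet> w \<noteq> 0" if "w \<in> insert v E" for w
    proof (cases "v \<bullet> w = 0")
      case True
      then have "w \<in> E" using that v by auto
      then show ?thesis using True a by (simp add: inner_left_distrib)
    next
      case False
      have "t \<noteq> - (a \<bullet> w) / (v \<bullet> w)" using t that by (auto simp: X_def)
      then show ?thesis using False by (simp add: inner_left_distrib field_simps)
    qed
    then show ?case by blast
  qed simp
  let ?E = "(\<lambda>(x, y). x - y) ` (D \<times> D) - {0}"
  obtain a where a: "\<forall>v\<in>?E. a \<bullet> v \<noteq> 0" using avoid[of ?E] assms by auto
  have "inj_on (\<lambda>x. a \<bullet> x) D"
  proof (rule inj_onI, rule ccontr)
    fix x y assume xy: "x \<in> D" "y \<in> D" "a \<bullet> x = a \<bullet> y" "x \<noteq> y"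
    then have "x - y \<in> ?E" by auto
    with a have "a \<bullet> (x - y) \<noteq> 0" by blast
    with xy show False by (simp add: inner_diff_right)
  qed
  then show ?thesis by blast
qed

section \<open>Lowest common points and the final count\<close>

context midpoint_set
begin

text \<open>With respect to a generic linear functional, Helly's theorem shows that the lowest common point
  of \<open>h\<close> sets is already the lowest common point of \<open>h - 1\<close> of them.\<close>
lemma popular_point:
  assumes conv: "\<And>i. i < n \<Longrightarrow> convex (F i)"
  defines "\<G> \<equiv> {I. I \<subseteq> {..<n} \<and> card I = h \<and> meets F I}"
  assumes nonempty: "\<G> \<noteq> {}"
  shows "\<exists>x\<in>S. card \<G> \<le> (n choose (h - 1)) * card {i. i < n \<and> x \<in> F i}"
proof -
  have "\<forall>I\<in>\<G>. \<exists>x. x \<in> S \<and> (\<forall>i\<in>I. x \<in> F i)" by (auto simp: \<G>_def meets_def)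
  from bchoice[OF this] obtain w where w: "\<forall>I\<in>\<G>. w I \<in> S \<and> (\<forall>i\<in>I. w I \<in> F i)" ..
  have fin\<G>: "finite \<G>" by (simp add: \<G>_def)
  define S0 where "S0 = S \<inter> convex hull (w ` \<G>)"
  have finS0: "finite S0"
    unfolding S0_def using w fin\<G> by (intro finite_hull) auto
  obtain a where a: "inj_on (\<lambda>x. a \<bullet> x) S0" using generic_functional[OF finS0] by blast
  define C where "C J = {x \<in> S0. \<forall>i\<in>J. x \<in> F i}" for J
  define \<mu> where "\<mu> J = arg_min_on (\<lambda>x. a \<bullet> x) (C J)" for J
  have wC: "w I \<in> C I" if "I \<in> \<G>" for I
    using w that by (auto simp: C_def S0_def hull_inc)
  have finC: "finite (C J)" for J using finS0 by (simp add: C_def)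
  have \<mu>C: "\<mu> J \<in> C J" and \<mu>_min: "x \<in> C J \<Longrightarrow> a \<bullet> \<mu> J \<le> a \<bullet> x" if "C J \<noteq> {}" for J x
    using arg_min_if_finite[OF finC that, of "\<lambda>x. a \<bullet> x"] by (auto simp: \<mu>_def not_less)
  have "\<exists>i\<in>I. \<mu> (I - {i}) = \<mu> I" if I: "I \<in> \<G>" for I
  proof (rule ccontr)
    assume differ: "\<not> ?thesis"
    have finI: "finite I" and cI: "card I = h" and In: "I \<subseteq> {..<n}"
      using I by (auto simp: \<G>_def intro: finite_subset)
    have CI: "C I \<noteq> {}" using wC[OF I] by auto
    \<comment> \<open>If deleting any one set of \<open>I\<close> lowered the minimum, then the
      \<open>h\<close> sets of \<open>I\<close> and the open half-space below \<open>\<mu> I\<close>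
      would meet \<open>h\<close> at a time, hence all together, in a point lower than the lowest
      point of \<open>C I\<close>. The intersection with the hull keeps that point in
      \<open>S0\<close>.\<close>
    define F' where "F' k = (case k of None \<Rightarrow> {x. a \<bullet> x < a \<bullet> \<mu> I}
      | Some i \<Rightarrow> F i \<inter> convex hull (w ` \<G>))" for k
    have "meets F' (insert None (Some ` I))"
    proof (rule helly_step)
      show "h < card (insert None (Some ` I))"
        using finI cI by (simp add: card_image card_insert_if)
      show "convex (F' k)" if "k \<in> insert None (Some ` I)" for k
      proof (cases k)
        case None
        then show ?thesis by (simp add: F'_def convex_halfspace_lt)
      next
        case (Some i)
        then have "i < n" using that In by auto
        then show ?thesis using Some conv by (simp add: F'_def convex_Int)
      qed
      show "meets F' (insert None (Some ` I) - {k})" if "k \<in> insert None (Some ` I)" for k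
      proof (cases k)
        case None
        have "\<mu> I \<in> S" "\<forall>i\<in>I. \<mu> I \<in> F' (Some i)"
          using \<mu>C[OF CI] by (auto simp: C_def S0_def F'_def)
        then show ?thesis using None unfolding meets_def by (intro bexI[of _ "\<mu> I"]) auto
      next
        case (Some i)
        then have i: "i \<in> I" using that by auto
        have sub: "C I \<subseteq> C (I - {i})" by (auto simp: C_def)
        then have ne: "C (I - {i}) \<noteq> {}" using CI by blast
        have "a \<bullet> \<mu> (I - {i}) \<le> a \<bullet> \<mu> I" using \<mu>_min[OF ne] \<mu>C[OF CI] sub by blast
        moreover have "a \<bullet> \<mu> (I - {i}) \<noteq> a \<bullet> \<mu> I"
          using inj_onD[OF a] \<mu>C[OF CI] \<mu>C[OF ne] differ i by (auto simp: C_def)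
        ultimately have "\<mu> (I - {i}) \<in> F' None" by (simp add: F'_def)
        moreover have "\<mu> (I - {i}) \<in> S" "\<forall>j\<in>I - {i}. \<mu> (I - {i}) \<in> F' (Some j)"
          using \<mu>C[OF ne] by (auto simp: C_def S0_def F'_def)
        ultimately show ?thesis
          using Some unfolding meets_def by (intro bexI[of _ "\<mu> (I - {i})"]) auto
      qed
    qed (use finI in simp)
    then obtain x where x: "x \<in> S" "x \<in> F' None" "\<And>i. i \<in> I \<Longrightarrow> x \<in> F' (Some i)"
      unfolding meets_def by auto
    have "I \<noteq> {}" using cI h_pos by auto
    then have "x \<in> C I" using x(1,3) by (auto simp: C_def S0_def F'_def)
    from \<mu>_min[OF CI this] x(2) show False by (simp add: F'_def)
  qed
  then have "\<forall>I\<in>\<G>. \<exists>i. i \<in> I \<and> \<mu> (I - {i}) = \<mu> I" by blast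
  from bchoice[OF this] obtain \<iota> where \<iota>: "\<forall>I\<in>\<G>. \<iota> I \<in> I \<and> \<mu> (I - {\<iota> I}) = \<mu> I" ..
  \<comment> \<open>Many \<open>I\<close> share the same \<open>J = I - {\<iota> I}\<close> and
    hence the lowest point \<open>\<mu> J\<close>. It lies in the sets \<open>F (\<iota> I)\<close>,
    whose indices are distinct because \<open>I\<close> is recovered from \<open>J\<close> and
    \<open>\<iota> I\<close>.\<close>
  define B where "B = {J. J \<subseteq> {..<n} \<and> card J = h - 1}"
  have "(\<lambda>I. I - {\<iota> I}) ` \<G> \<subseteq> B"
    using \<iota> by (auto simp: B_def \<G>_def)
  moreover from this have "B \<noteq> {}" using nonempty by blast
  moreover have "finite B" by (simp add: B_def)
  ultimately obtain J where J: "J \<in> B" "card \<G> \<le> card B * card {I \<in> \<G>. I - {\<iota> I} = J}"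
    using pigeonhole_average[OF fin\<G>, of B "\<lambda>I. I - {\<iota> I}"] by blast
  have "card \<G> \<noteq> 0" using nonempty fin\<G> by simp
  with J(2) have "{I \<in> \<G>. I - {\<iota> I} = J} \<noteq> {}" by (metis card.empty le_zero_eq mult_0_right)
  then obtain I0 where I0: "I0 \<in> \<G>" "I0 - {\<iota> I0} = J" by blast
  have \<mu>J: "\<mu> J \<in> C I" if "I \<in> \<G>" "I - {\<iota> I} = J" for I
  proof -
    have "C I \<noteq> {}" using wC[OF that(1)] by blast
    moreover have "\<mu> J = \<mu> I" using \<iota> that by blast
    ultimately show ?thesis using \<mu>C[of I] by simp
  qed
  have "\<mu> J \<in> S" using \<mu>J[OF I0] by (simp add: C_def S0_def)
  moreover have "card {I \<in> \<G>. I - {\<iota> I} = J} \<le> card {i. i < n \<and> \<mu> J \<in> F i}"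
  proof (rule card_inj_on_le)
    show "inj_on \<iota> {I \<in> \<G>. I - {\<iota> I} = J}"
    proof (rule inj_onI)
      fix I I' assume "I \<in> {I \<in> \<G>. I - {\<iota> I} = J}" "I' \<in> {I \<in> \<G>. I - {\<iota> I} = J}" "\<iota> I = \<iota> I'"
      then show "I = I'" using \<iota> by (metis (mono_tags, lifting) insert_Diff mem_Collect_eq)
    qed
    show "\<iota> ` {I \<in> \<G>. I - {\<iota> I} = J} \<subseteq> {i. i < n \<and> \<mu> J \<in> F i}"
    proof clarify
      fix I assume I: "I \<in> \<G>" "J = I - {\<iota> I}"
      then have "\<mu> (I - {\<iota> I}) \<in> C I" using \<mu>J by blast
      then show "\<iota> I < n \<and> \<mu> (I - {\<iota> I}) \<in> F (\<iota> I)"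
        using \<iota> I(1) by (auto simp: C_def \<G>_def)
    qed
  qed simp
  ultimately show ?thesis
    using J(2) by (intro bexI[of _ "\<mu> J"])
      (auto simp: B_def n_subsets intro: order_trans mult_left_mono)
qed

lemma fractional_helly_property: "fractional_helly_property S (DIM('a) + 1)"
  unfolding fractional_helly_property_def
proof (intro allI impI)
  fix \<alpha> :: real assume "0 < \<alpha> \<and> \<alpha> \<le> 1"
  then have \<alpha>: "0 < \<alpha>" by simp
  define k where "k = DIM('a) + 1"
  from \<alpha> have "0 < \<alpha> / 2" by simp
  from dense_imp_meets[OF this] obtain N where N: "k + h \<le> N"
    and local: "\<forall>A (F :: nat \<Rightarrow> 'a set). finite A \<longrightarrow> card A = N \<longrightarrow> (\<forall>i\<in>A. convex (F i)) \<longrightarrow>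
      \<alpha> / 2 * (N choose k) \<le> card {I. I \<subseteq> A \<and> card I = k \<and> meets F I} \<longrightarrow>
      (\<exists>J\<subseteq>A. card J = h \<and> meets F J)"
    unfolding k_def by blast
  \<comment> \<open>A lower bound for the density of the \<open>h\<close>-sets that meet in
    \<open>S\<close>, as obtained by averaging over \<open>N\<close>-sets.\<close>
  define \<gamma> where "\<gamma> = \<alpha> / 2 / (N choose h)"
  have Nh: "0 < real (N choose h)" using N by simp
  have \<gamma>: "0 < \<gamma>" unfolding \<gamma>_def using \<alpha> Nh by simp
  \<comment> \<open>From \<open>N0\<close> on, \<open>N <= n\<close> permits the averaging and
    \<open>2 * h <= n\<close> gives \<open>n / 2 <= n - (h - 1)\<close>.\<close>
  define N0 where "N0 = N + 2 * h"
  have N0: "0 < N0" using h_pos by (simp add: N0_def)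
  \<comment> \<open>The first term serves \<open>n < N0\<close>, where a point in a single set
    suffices; the second is the outcome of the count for larger \<open>n\<close>.\<close>
  define \<beta> where "\<beta> = min (1 / N0) (\<gamma> / (2 * h))"
  have \<beta>: "0 < \<beta>" using N0 \<gamma> h_pos by (simp add: \<beta>_def)
  have main: "\<exists>x\<in>S. \<beta> * n \<le> card {i. i < n \<and> x \<in> F i}"
    if kn: "k \<le> n" and conv: "\<forall>i<n. convex (F i)"
      and dens: "\<alpha> * (n choose k) \<le> card {I. I \<subseteq> {..<n} \<and> card I = k \<and> (\<exists>x\<in>S. \<forall>i\<in>I. x \<in> F i)}"
    for n and F :: "nat \<Rightarrow> 'a set"
  proof (cases "n < N0")
    case True
    \<comment> \<open>Here \<open>k <= n\<close> is essential: the positive binomial coefficient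
      forces at least one tuple to meet in \<open>S\<close>.\<close>
    have "0 < \<alpha> * (n choose k)" using \<alpha> kn by simp
    with dens have "card {I. I \<subseteq> {..<n} \<and> card I = k \<and> (\<exists>x\<in>S. \<forall>i\<in>I. x \<in> F i)} \<noteq> 0" by linarith
    then have "{I. I \<subseteq> {..<n} \<and> card I = k \<and> (\<exists>x\<in>S. \<forall>i\<in>I. x \<in> F i)} \<noteq> {}" by (metis card.empty)
    then obtain I x where I: "I \<subseteq> {..<n}" "card I = k" and x: "x \<in> S" "\<forall>i\<in>I. x \<in> F i" by blast
    have "I \<noteq> {}" using I(2) by (auto simp: k_def)
    then obtain i where "i \<in> I" by blast
    then have "i \<in> {i. i < n \<and> x \<in> F i}" using I x by auto
    then have "{i. i < n \<and> x \<in> F i} \<noteq> {}" by blast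
    then have "1 \<le> card {i. i < n \<and> x \<in> F i}" by (simp add: Suc_le_eq card_gt_0_iff)
    moreover have "\<beta> * n \<le> 1"
    proof -
      have "\<beta> * n \<le> 1 / N0 * n" by (intro mult_right_mono) (auto simp: \<beta>_def)
      also have "\<dots> \<le> 1" using True by simp
      finally show ?thesis .
    qed
    ultimately show ?thesis using x(1) by (intro bexI[of _ x]) auto
  next
    case False
    define g where "g = card {J. J \<subseteq> {..<n} \<and> card J = h \<and> meets F J}"
    have nN: "N \<le> n" and hn: "h \<le> n" "2 * h \<le> n" using False by (simp_all add: N0_def)
    have "\<alpha> / 2 * (card {..<n} choose h) \<le> (N choose h) * card {J. J \<subseteq> {..<n} \<and> card J = h \<and> meets F J}"
    proof (rule subset_density_lift[where k = k and P = "meets F"])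
      show "\<alpha> * (card {..<n} choose k) \<le> card {I. I \<subseteq> {..<n} \<and> card I = k \<and> meets F I}"
        using dens by (simp add: meets_def)
      fix A assume A: "A \<subseteq> {..<n}" "card A = N"
        "\<alpha> / 2 * (N choose k) \<le> card {I. I \<subseteq> A \<and> card I = k \<and> meets F I}"
      have "finite A" using A(1) finite_subset by blast
      moreover have "\<forall>i\<in>A. convex (F i)" using A(1) conv by auto
      ultimately show "\<exists>J\<subseteq>A. card J = h \<and> meets F J" using A(2,3) local by blast
    qed (use \<alpha> N nN in auto)
    then have g: "\<gamma> * (n choose h) \<le> g"
      using Nh by (simp add: \<gamma>_def g_def pos_divide_le_eq mult.commute)
    have "0 < \<gamma> * (n choose h)" using \<gamma> hn by simp
    with g have "g \<noteq> 0" by auto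
    then have "{J. J \<subseteq> {..<n} \<and> card J = h \<and> meets F J} \<noteq> {}" unfolding g_def by (metis card.empty)
    then obtain x where x: "x \<in> S" "g \<le> (n choose (h - 1)) * card {i. i < n \<and> x \<in> F i}"
      using popular_point[of n F] conv unfolding g_def by blast
    define c where "c = card {i. i < n \<and> x \<in> F i}"
    \<comment> \<open>By this identity, dividing by \<open>n choose (h - 1)\<close> turns the bound
      \<open>\<gamma> * (n choose h) <= g\<close> into the lower bound
      \<open>\<gamma> * (n - (h - 1)) / h\<close> for \<open>c\<close>.\<close>
    have absorb: "h * (n choose h) = (n - (h - 1)) * (n choose (h - 1))"
      using times_binomial_minus1_eq[OF h_pos, of n] binomial_absorb_comp[of n "h - 1"] by simp
    have pos: "0 < real (n choose (h - 1))" using hn by simp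
    have "\<gamma> * (n - (h - 1)) * (n choose (h - 1)) = h * (\<gamma> * (n choose h))"
      using arg_cong[OF absorb, of real] by simp
    also have "\<dots> \<le> h * real ((n choose (h - 1)) * c)"
      using g x(2) unfolding c_def by (intro mult_left_mono order_trans[OF g] of_nat_mono) auto
    finally have "(\<gamma> * (n - (h - 1))) * (n choose (h - 1)) \<le> (h * real c) * (n choose (h - 1))"
      by (simp add: mult_ac)
    then have "\<gamma> * (n - (h - 1)) \<le> h * real c" using pos by (rule mult_right_le_imp_le)
    moreover have "\<gamma> * (n / 2) \<le> \<gamma> * (n - (h - 1))"
      using \<gamma> hn by (intro mult_left_mono) linarith+
    ultimately have "\<gamma> * n \<le> (2 * h) * real c" by simp
    then have "\<gamma> / (2 * h) * n \<le> c" using h_pos by (simp add: pos_divide_le_eq mult.commute)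
    moreover have "\<beta> * n \<le> \<gamma> / (2 * h) * n" by (intro mult_right_mono) (auto simp: \<beta>_def)
    ultimately have "\<beta> * n \<le> c" by linarith
    then show ?thesis using x(1) unfolding c_def by (rule bexI[of _ x])
  qed
  show "\<exists>\<beta>::real. 0 < \<beta> \<and> (\<forall>n (F :: nat \<Rightarrow> 'a set). DIM('a) + 1 \<le> n \<longrightarrow> (\<forall>i<n. convex (F i)) \<longrightarrow>
    \<alpha> * (n choose (DIM('a) + 1)) \<le>
      card {I. I \<subseteq> {..<n} \<and> card I = DIM('a) + 1 \<and> (\<exists>x\<in>S. \<forall>i\<in>I. x \<in> F i)} \<longrightarrow>
    (\<exists>x\<in>S. \<beta> * n \<le> card {i. i < n \<and> x \<in> F i}))"
    unfolding k_def[symmetric]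
  proof (rule exI[of _ \<beta>], rule conjI[OF \<beta>], (rule allI)+, (rule impI)+)
    fix n and F :: "nat \<Rightarrow> 'a set"
    assume "k \<le> n" "\<forall>i<n. convex (F i)"
      "\<alpha> * (n choose k) \<le> card {I. I \<subseteq> {..<n} \<and> card I = k \<and> (\<exists>x\<in>S. \<forall>i\<in>I. x \<in> F i)}"
    then show "\<exists>x\<in>S. \<beta> * n \<le> card {i. i < n \<and> x \<in> F i}" by (rule main)
  qed
qed

end

section \<open>Crystals and cut-and-project sets\<close>

text \<open>\<open>\<kappa>\<close> records the basis vectors with odd coefficient. Equal parities
  make all coefficients of the sum even, so it can be halved inside the lattice.\<close>

lemma full_rank_lattice_parity:
  fixes L :: "'a::euclidean_space set"
  assumes "full_rank_lattice L"
  shows "\<exists>\<kappa> :: 'a \<Rightarrow> 'a set. finite (\<kappa> ` L) \<and>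
    (\<forall>x\<in>L. \<forall>y\<in>L. \<kappa> x = \<kappa> y \<longrightarrow> midpoint x y \<in> L)"
proof -
  obtain B where B: "independent B"
    and L: "L = {\<Sum>b\<in>B. of_int (c b) *\<^sub>R b |c :: 'a \<Rightarrow> int. True}"
    using assms unfolding full_rank_lattice_def by blast
  have finB: "finite B" using B by (rule independent_imp_finite)
  have "\<forall>x\<in>L. \<exists>c :: 'a \<Rightarrow> int. x = (\<Sum>b\<in>B. of_int (c b) *\<^sub>R b)" using L by blast
  from bchoice[OF this] obtain c :: "'a \<Rightarrow> 'a \<Rightarrow> int"
    where c: "\<forall>x\<in>L. x = (\<Sum>b\<in>B. of_int (c x b) *\<^sub>R b)" ..
  define \<kappa> where "\<kappa> x = {b \<in> B. odd (c x b)}" for x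
  have "midpoint x y \<in> L" if xy: "x \<in> L" "y \<in> L" "\<kappa> x = \<kappa> y" for x y
  proof -
    define d where "d b = (c x b + c y b) div 2" for b
    have d: "(1 / 2) * (real_of_int (c x b) + real_of_int (c y b)) = real_of_int (d b)" if "b \<in> B" for b
    proof -
      have "odd (c x b) \<longleftrightarrow> odd (c y b)" using xy(3) that unfolding \<kappa>_def by blast
      then have "even (c x b + c y b)" by simp
      then have "c x b + c y b = 2 * d b" by (simp add: d_def)
      then have "real_of_int (c x b) + real_of_int (c y b) = 2 * real_of_int (d b)"
        by (metis of_int_add of_int_mult of_int_numeral)
      then show ?thesis by simp
    qed
    have "midpoint x y = (1 / 2) *\<^sub>R ((\<Sum>b\<in>B. of_int (c x b) *\<^sub>R b) + (\<Sum>b\<in>B. of_int (c y b) *\<^sub>R b))"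
      using bspec[OF c xy(1)] bspec[OF c xy(2)] unfolding midpoint_def by (simp add: inverse_eq_divide)
    also have "\<dots> = (\<Sum>b\<in>B. ((1 / 2) * (real_of_int (c x b) + real_of_int (c y b))) *\<^sub>R b)"
      unfolding sum.distrib[symmetric] scaleR_right.sum
      by (intro sum.cong) (simp_all add: scaleR_left_distrib scaleR_right_distrib add_divide_distrib)
    also have "\<dots> = (\<Sum>b\<in>B. of_int (d b) *\<^sub>R b)"
      using d by (intro sum.cong) simp_all
    finally show ?thesis unfolding L by blast
  qed
  moreover have "\<kappa> ` L \<subseteq> Pow B" by (auto simp: \<kappa>_def)
  then have "finite (\<kappa> ` L)" using finB by (meson finite_Pow_iff finite_subset)
  ultimately show ?thesis by blast
qed

text \<open>Each coordinate is the restriction of a linear functional, hence bounded on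
  \<open>X\<close>, which leaves finitely many integer coefficient vectors.\<close>

lemma full_rank_lattice_locally_finite:
  fixes L :: "'a::euclidean_space set"
  assumes "full_rank_lattice L" "bounded X"
  shows "finite (L \<inter> X)"
proof -
  obtain B where B: "independent B"
    and L: "L = {\<Sum>b\<in>B. of_int (c b) *\<^sub>R b |c :: 'a \<Rightarrow> int. True}"
    using assms unfolding full_rank_lattice_def by blast
  have finB: "finite B" using B by (rule independent_imp_finite)
  obtain r where r: "\<forall>x\<in>X. norm x \<le> r" using assms(2) unfolding bounded_iff ..
  have "\<forall>b\<in>B. \<exists>M :: int. \<forall>c :: 'a \<Rightarrow> int. (\<Sum>b\<in>B. of_int (c b) *\<^sub>R b) \<in> X \<longrightarrow> \<bar>c b\<bar> \<le> M"
  proof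
    fix b assume b: "b \<in> B"
    have "\<exists>g :: 'a \<Rightarrow> real. linear g \<and> (\<forall>x\<in>B. g x = (if x = b then 1 else 0))"
      using B by (rule linear_independent_extend)
    then obtain g :: "'a \<Rightarrow> real" where g: "linear g" "\<forall>x\<in>B. g x = (if x = b then 1 else 0)"
      by blast
    obtain K where K: "\<forall>x. norm (g x) \<le> K * norm x" using linear_bounded[OF g(1)] ..
    have "\<bar>c b\<bar> \<le> \<lceil>\<bar>K\<bar> * r\<rceil>" if "(\<Sum>b\<in>B. of_int (c b) *\<^sub>R b) \<in> X" for c :: "'a \<Rightarrow> int"
    proof -
      let ?x = "\<Sum>b\<in>B. of_int (c b) *\<^sub>R b"
      have "g ?x = (\<Sum>x\<in>B. of_int (c x) * g x)"
        using g(1) by (simp add: linear_sum linear_cmul)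
      also have "\<dots> = (\<Sum>x\<in>B. if x = b then of_int (c b) else 0)"
        using g(2) by (intro sum.cong) auto
      also have "\<dots> = of_int (c b)" using finB b by simp
      finally have "\<bar>real_of_int (c b)\<bar> \<le> K * norm ?x" using spec[OF K, of ?x] by simp
      also have "\<dots> \<le> \<bar>K\<bar> * norm ?x" by (intro mult_right_mono) auto
      also have "\<dots> \<le> \<bar>K\<bar> * r" using bspec[OF r that] by (intro mult_left_mono) auto
      finally show ?thesis by linarith
    qed
    then show "\<exists>M :: int. \<forall>c :: 'a \<Rightarrow> int. (\<Sum>b\<in>B. of_int (c b) *\<^sub>R b) \<in> X \<longrightarrow> \<bar>c b\<bar> \<le> M" by blast
  qed
  from bchoice[OF this] obtain M where
    M: "\<forall>b\<in>B. \<forall>c :: 'a \<Rightarrow> int. (\<Sum>b\<in>B. of_int (c b) *\<^sub>R b) \<in> X \<longrightarrow> \<bar>c b\<bar> \<le> M b" ..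
  have "L \<inter> X \<subseteq> (\<lambda>c. \<Sum>b\<in>B. of_int (c b) *\<^sub>R b) ` PiE B (\<lambda>b. {- M b..M b})"
  proof
    fix x assume x: "x \<in> L \<inter> X"
    then obtain c :: "'a \<Rightarrow> int" where c: "x = (\<Sum>b\<in>B. of_int (c b) *\<^sub>R b)" unfolding L by blast
    have "(\<Sum>b\<in>B. of_int (c b) *\<^sub>R b) \<in> X" using x c by blast
    then have "restrict c B \<in> PiE B (\<lambda>b. {- M b..M b})"
      using M by (intro restrict_PiE_iff[THEN iffD2] ballI) (fastforce simp: abs_le_iff)
    moreover have "x = (\<Sum>b\<in>B. of_int (restrict c B b) *\<^sub>R b)"
      unfolding c by (intro sum.cong) simp_all
    ultimately show "x \<in> (\<lambda>c. \<Sum>b\<in>B. of_int (c b) *\<^sub>R b) ` PiE B (\<lambda>b. {- M b..M b})" by blast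
  qed
  moreover have "finite (PiE B (\<lambda>b. {- M b..M b}))" using finB by (intro finite_PiE) auto
  ultimately show ?thesis by (meson finite_imageI finite_subset)
qed

text \<open>Among more points than colours two share a colour. \<open>Suc\<close> keeps the number
  positive even when there are no colours.\<close>

lemma midpoint_setI:
  fixes S :: "'a::euclidean_space set" and \<gamma> :: "'a \<Rightarrow> 'c"
  assumes loc: "\<And>X. bounded X \<Longrightarrow> finite (S \<inter> X)"
    and fin: "finite (\<gamma> ` S)"
    and mid: "\<And>x y. x \<in> S \<Longrightarrow> y \<in> S \<Longrightarrow> \<gamma> x = \<gamma> y \<Longrightarrow> midpoint x y \<in> S"
  shows "midpoint_set S (Suc (card (\<gamma> ` S)))"
proof
  fix A assume A: "finite A" "A \<subseteq> S"
  then show "finite (S \<inter> convex hull A)"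
    by (intro loc bounded_convex_hull finite_imp_bounded)
  assume "Suc (card (\<gamma> ` S)) < card A"
  moreover have "card (\<gamma> ` A) \<le> card (\<gamma> ` S)" using A fin by (intro card_mono image_mono)
  ultimately have "\<not> inj_on \<gamma> A" using card_image[of \<gamma> A] by linarith
  then obtain x y where "x \<in> A" "y \<in> A" "x \<noteq> y" "\<gamma> x = \<gamma> y" unfolding inj_on_def by blast
  with A mid show "\<exists>x\<in>A. \<exists>y\<in>A. x \<noteq> y \<and> midpoint x y \<in> S" by blast
qed simp

text \<open>A point is coloured by a translate containing it and the parity class of its lattice
  part; for equal colours the midpoint stays in the same translate.\<close>

lemma crystal_midpoint_set:
  assumes "crystal S"
  shows "\<exists>h. midpoint_set S h"
proof -
  obtain L T where L: "full_rank_lattice L" and T: "finite T"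
    and S: "S = (\<Union>t\<in>T. (\<lambda>x. x + t) ` L)"
    using assms unfolding crystal_def by blast
  obtain \<kappa> :: "'a \<Rightarrow> 'a set" where \<kappa>: "finite (\<kappa> ` L)"
    "\<And>x y. x \<in> L \<Longrightarrow> y \<in> L \<Longrightarrow> \<kappa> x = \<kappa> y \<Longrightarrow> midpoint x y \<in> L"
    using full_rank_lattice_parity[OF L] by blast
  have "\<forall>x\<in>S. \<exists>t. t \<in> T \<and> x - t \<in> L" unfolding S by auto
  from bchoice[OF this] obtain \<tau> where \<tau>: "\<forall>x\<in>S. \<tau> x \<in> T \<and> x - \<tau> x \<in> L" ..
  have "midpoint_set S (Suc (card ((\<lambda>x. (\<tau> x, \<kappa> (x - \<tau> x))) ` S)))"
  proof (rule midpoint_setI)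
    fix X :: "'a set" assume X: "bounded X"
    have "S \<inter> X \<subseteq> (\<Union>t\<in>T. (\<lambda>x. x + t) ` (L \<inter> (\<lambda>x. x - t) ` X))"
      unfolding S by force
    moreover have "bounded ((\<lambda>x. x - t) ` X)" for t
      using X bounded_translation_minus by blast
    ultimately show "finite (S \<inter> X)"
      using T L full_rank_lattice_locally_finite by (meson finite_UN_I finite_imageI finite_subset)
  next
    have "(\<lambda>x. (\<tau> x, \<kappa> (x - \<tau> x))) ` S \<subseteq> T \<times> \<kappa> ` L" using \<tau> by blast
    then show "finite ((\<lambda>x. (\<tau> x, \<kappa> (x - \<tau> x))) ` S)"
      by (rule finite_subset) (intro finite_cartesian_product T \<kappa>(1))
  next
    fix x y assume xy: "x \<in> S" "y \<in> S" "(\<tau> x, \<kappa> (x - \<tau> x)) = (\<tau> y, \<kappa> (y - \<tau> y))"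
    from xy(3) have eq: "\<tau> x = \<tau> y" "\<kappa> (x - \<tau> x) = \<kappa> (y - \<tau> y)"
      unfolding prod.inject by blast+
    have "x - \<tau> x \<in> L" "y - \<tau> y \<in> L" using \<tau> xy(1,2) by blast+
    then have "midpoint (x - \<tau> x) (y - \<tau> y) \<in> L" using eq(2) by (rule \<kappa>(2))
    then have "midpoint (x - \<tau> x) (y - \<tau> x) \<in> L" unfolding eq(1) .
    moreover have "midpoint x y = midpoint (x - \<tau> x) (y - \<tau> x) + \<tau> x"
    proof -
      define M where "M = midpoint (x - \<tau> x) (y - \<tau> x)"
      then have "(x - \<tau> x) + (y - \<tau> x) = M + M" using midpoint_eq_iff by blast
      then have "x + y = (M + \<tau> x) + (M + \<tau> x)" by (simp add: algebra_simps)
      then show ?thesis unfolding M_def[symmetric] midpoint_eq_iff .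
    qed
    ultimately show "midpoint x y \<in> S" unfolding S using \<tau> xy(1) by blast
  qed
  then show ?thesis by blast
qed

text \<open>Points are coloured by the parity class of a lift to \<open>L\<close>. The midpoint of
  two lifts of equal colour is in \<open>L\<close>, and convexity keeps its second component in
  \<open>W\<close>. Lifts of points of a bounded \<open>X\<close> lie in the bounded set
  \<open>X \<times> W\<close>, which gives local finiteness.\<close>

lemma cut_and_project_midpoint_set:
  fixes L :: "('a::euclidean_space \<times> 'b::euclidean_space) set"
  assumes "full_rank_lattice L" "bounded W" "convex W"
  shows "\<exists>h. midpoint_set (cut_and_project_set L W) h"
proof -
  define S where "S = cut_and_project_set L W"
  have S: "S = {fst z |z. z \<in> L \<and> snd z \<in> W}" by (simp add: S_def cut_and_project_set_def)
  obtain \<kappa> :: "'a \<times> 'b \<Rightarrow> ('a \<times> 'b) set" where \<kappa>: "finite (\<kappa> ` L)"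
    "\<And>x y. x \<in> L \<Longrightarrow> y \<in> L \<Longrightarrow> \<kappa> x = \<kappa> y \<Longrightarrow> midpoint x y \<in> L"
    using full_rank_lattice_parity[OF assms(1)] by blast
  have "\<forall>x\<in>S. \<exists>z. z \<in> L \<and> snd z \<in> W \<and> fst z = x" unfolding S by blast
  from bchoice[OF this] obtain z where z: "\<forall>x\<in>S. z x \<in> L \<and> snd (z x) \<in> W \<and> fst (z x) = x" ..
  have "midpoint_set S (Suc (card ((\<lambda>x. \<kappa> (z x)) ` S)))"
  proof (rule midpoint_setI)
    fix X :: "'a set" assume "bounded X"
    then have "finite (L \<inter> (X \<times> W))"
      using assms(1,2) by (intro full_rank_lattice_locally_finite bounded_Times)
    moreover have "S \<inter> X \<subseteq> fst ` (L \<inter> (X \<times> W))" unfolding S by force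
    ultimately show "finite (S \<inter> X)" by (meson finite_imageI finite_subset)
  next
    have "(\<lambda>x. \<kappa> (z x)) ` S \<subseteq> \<kappa> ` L" using z by blast
    then show "finite ((\<lambda>x. \<kappa> (z x)) ` S)" using \<kappa>(1) by (rule finite_subset)
  next
    fix x y assume xy: "x \<in> S" "y \<in> S" "\<kappa> (z x) = \<kappa> (z y)"
    have mid: "midpoint (z x) (z y) \<in> L" using \<kappa>(2) z xy by blast
    have "snd (midpoint (z x) (z y)) = midpoint (snd (z x)) (snd (z y))"
      by (simp add: midpoint_def)
    then have "snd (midpoint (z x) (z y)) \<in> W"
      using z xy(1,2) convexD[OF assms(3), of "snd (z x)" "snd (z y)" "1/2" "1/2"]
      by (simp add: midpoint_def scaleR_right_distrib inverse_eq_divide)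
    moreover have "fst (midpoint (z x) (z y)) = midpoint x y"
      using z xy(1,2) by (simp add: midpoint_def)
    ultimately show "midpoint x y \<in> S"
      unfolding S using mid by (intro CollectI exI[of _ "midpoint (z x) (z y)"]) simp
  qed
  then show ?thesis unfolding S_def by blast
qed

theorem corollary3p8:
  fixes S :: "'a::euclidean_space set"
    and L :: "('a \<times> 'b::euclidean_space) set"
    and W :: "'b set"
  assumes "crystal S \<or>
    (cut_and_project_scheme L \<and> is_window W \<and> convex W \<and> S = cut_and_project_set L W)"
  shows "fractional_helly_number S \<le> enat (DIM('a) + 1) \<and>
    fractional_helly_property S (DIM('a) + 1)"
proof -
  have "\<exists>h. midpoint_set S h"
    using assms
  proof
    assume "crystal S"
    then show ?thesis by (rule crystal_midpoint_set)
  next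
    assume A: "cut_and_project_scheme L \<and> is_window W \<and> convex W \<and> S = cut_and_project_set L W"
    then have "bounded W"
      unfolding is_window_def by (metis bounded_subset closure_subset compact_imp_bounded)
    moreover from A have "full_rank_lattice L" "convex W" and S: "S = cut_and_project_set L W"
      unfolding cut_and_project_scheme_def by simp_all
    ultimately show ?thesis unfolding S by (intro cut_and_project_midpoint_set)
  qed
  then obtain h where "midpoint_set S h" ..
  then have "fractional_helly_property S (DIM('a) + 1)"
    by (rule midpoint_set.fractional_helly_property)
  then show ?thesis
    unfolding fractional_helly_number_def by (intro conjI INF_lower) simp_all
qed

end
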